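(* Consider the finite sum case $f(x)=\frac1n\sum_{i=1}^n f_i(x)$, $f_i(x)=\frac1m\sum_{j=1}^m f_{ij}(x)$, $x\in\mathbb{R}^d$. Assume there exists $f_*\in\mathbb{R}$ with $f(x)\ge f_*$ for all $x\in\mathbb{R}^d$; that $f_i$ is $L_i$-smooth for all $i\in\{1,\dots,n\}$, i.e. $\|\nabla f_i(x)-\nabla f_i(y)\|\le L_i\|x-y\|$ for all $x,y\in\mathbb{R}^d$; and that the average $\mathcal{L}$-smoothness assumption (see context) holds with constants $\mathcal{L}_i\ge0$. Let $\mathcal{Q}$ be a quantization operator with parameter $\omega$ and expected density $\zeta_{\mathcal Q}$, let $p\in(0,1]$, and let $$\gamma\le\frac{1}{L+\sqrt{\frac{1-p}{pn}\left(\omega L^2+\frac{(1+\omega)\mathcal{L}^2}{b'}\right)}},$$ where $L^2=\frac1n\sum_{i=1}^nL_i^2$ and $\mathcal{L}^2=\frac1n\sum_{i=1}^n\mathcal{L}_i^2$. Then after $K$ iterations of VR-MARINA (finite sum case) we have $$\mathbf{E}\left[\|\nabla f(\hat x^K)\|^2\right]\le\frac{2\Delta_0}{\gamma K},$$ where $\hat x^K$ is chosen uniformly at random from $x^0,\dots,x^{K-1}$ and $\Delta_0=f(x^0)-f_*$. That is, after $$K=\mathcal{O}\left(\frac{\Delta_0}{\varepsilon^2}\left(L+\sqrt{\frac{1-p}{pn}\left(\omega L^2+\frac{(1+\omega)\mathcal{L}^2}{b'}\right)}\right)\right)$$ iterations VR-MARINA produces such a point $\hat x^K$ that $\mathbf{E}[\|\nabla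 f(\hat x^K)\|^2]\le\varepsilon^2$, and the expected total number of stochastic oracle calls per node equals $$m+K(pm+2(1-p)b')=\mathcal{O}\left(m+\frac{\Delta_0}{\varepsilon^2}\left(L+\sqrt{\frac{1-p}{pn}\left(\omega L^2+\frac{(1+\omega)\mathcal{L}^2}{b'}\right)}\right)(pm+(1-p)b')\right).$$ Moreover, under an assumption that the communication cost is proportional to the number of non-zero components of transmitted vectors from workers to the server, the expected total communication cost per worker equals $$d+K(pd+(1-p)\zeta_{\mathcal Q})=\mathcal{O}\left(d+\frac{\Delta_0}{\varepsilon^2}\left(L+\sqrt{\frac{1-p}{pn}\left(\omega L^2+\frac{(1+\omega)\mathcal{L}^2}{b'}\right)}\right)(pd+(1-p)\zeta_{\mathcal Q})\right).$$
   Context: $\|\cdot\|$ is the Euclidean norm; $\|y\|_0$ is the number of non-zero components of $y\in\mathbb{R}^d$. Quantization operator: a stochastic mapping $\mathcal{Q}:\mathbb{R}^d\to\mathbb{R}^d$ for which there is $\omega>0$ with $\mathbf{E}[\mathcal{Q}(x)]=x$ and $\mathbf{E}[\|\mathcal{Q}(x)-x\|^2]\le\omega\|x\|^2$ for any $x\in\mathbb{R}^d$. Its expected density is $\zeta_{\mathcal Q}=\sup_{x\in\mathbb{R}^d}\mathbf{E}[\|\mathcal{Q}(x)\|_0]$. VR-MARINA, finite sum case (a distributed method with $n$ workers, worker $i$ having access to $f_i$, and a server; input: starting point $x^0$, stepsize $\gamma$, minibatch size $b'$, probability $p\in(0,1]$, number of iterations $K$): initialize $g^0=\nabla f(x^0)$.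 For $k=0,\dots,K-1$: sample $c_k\sim\mathrm{Bernoulli}(p)$ and broadcast $g^k$ to all workers; each worker $i=1,\dots,n$ in parallel computes $x^{k+1}=x^k-\gamma g^k$ and sets $g_i^{k+1}=\nabla f_i(x^{k+1})$ if $c_k=1$, and $g_i^{k+1}=g^k+\mathcal{Q}(\widetilde\Delta_i^k)$ otherwise, where $\widetilde\Delta_i^k=\frac1{b'}\sum_{j\in I'_{i,k}}(\nabla f_{ij}(x^{k+1})-\nabla f_{ij}(x^k))$ and $I'_{i,k}$ is the set of the indices in the minibatch, $|I'_{i,k}|=b'$; then $g^{k+1}=\frac1n\sum_{i=1}^n g_i^{k+1}$. Return $\hat x^K$ chosen uniformly at random from $\{x^k\}_{k=0}^{K-1}$. Average $\mathcal{L}$-smoothness: for all $k\ge0$ and $i\in\{1,\dots,n\}$, with $\Delta_i^k=\nabla f_i(x^{k+1})-\nabla f_i(x^k)$, one has $\mathbf{E}[\widetilde\Delta_i^k\mid x^k,x^{k+1}]=\Delta_i^k$ and $\mathbf{E}[\|\widetilde\Delta_i^k-\Delta_i^k\|^2\mid x^k,x^{k+1}]\le\frac{\mathcal{L}_i^2}{b'}\|x^{k+1}-x^k\|^2$ with some $\mathcal{L}_i\ge0$. A stochastic oracle call is the computation of one gradient $\nabla f_{ij}$ at one point.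
   Formalization: Communication "equals" holds when uncompressed vectors are charged d and quantized ones ζ_Q; for actual nonzeros (0 if all gradients vanish) it is "≤". K=O(T) reads 1≤K≤2T+1, for maximal γ. Coins, minibatches and quantizer draws are jointly independent. *)

theory Defs
  imports "HOL-Probability.Probability"
begin

definition grad :: "('a::real_inner \<Rightarrow> real) \<Rightarrow> 'a \<Rightarrow> 'a" where
  "grad h x = (THE D. GDERIV h x :> D)"

definition smooth_with :: "real \<Rightarrow> ('a::real_inner \<Rightarrow> real) \<Rightarrow> bool" where
  "smooth_with L h \<longleftrightarrow> (\<forall>x y. norm (grad h x - grad h y) \<le> L * norm (x - y))"

definition local_loss :: "nat \<Rightarrow> (nat \<Rightarrow> nat \<Rightarrow> 'a \<Rightarrow> real) \<Rightarrow> nat \<Rightarrow> 'a \<Rightarrow> real" where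
  "local_loss m f i x = (1 / real m) * (\<Sum>j<m. f i j x)"

definition global_loss :: "nat \<Rightarrow> nat \<Rightarrow> (nat \<Rightarrow> nat \<Rightarrow> 'a \<Rightarrow> real) \<Rightarrow> 'a \<Rightarrow> real" where
  "global_loss n m f x = (1 / real n) * (\<Sum>i<n. local_loss m f i x)"

definition rms :: "nat \<Rightarrow> (nat \<Rightarrow> real) \<Rightarrow> real" where
  "rms n L = sqrt ((1 / real n) * (\<Sum>i<n. (L i)\<^sup>2))"

definition l0_norm :: "real ^ 'd \<Rightarrow> nat" where
  "l0_norm y = card {l. y $ l \<noteq> 0}"

(* A stochastic mapping is a jointly measurable function of its argument and of a random
   seed s with law S; each application of the mapping draws its own seed. *)
definition quantization_operator ::
    "'s measure \<Rightarrow> ('s \<Rightarrow> real ^ 'd \<Rightarrow> real ^ 'd) \<Rightarrow> real \<Rightarrow> bool" where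
  "quantization_operator S Q \<omega> \<longleftrightarrow>
     prob_space S \<and>
     (\<lambda>(s, x). Q s x) \<in> borel_measurable (S \<Otimes>\<^sub>M borel) \<and>
     0 < \<omega> \<and>
     (\<forall>x. integrable S (\<lambda>s. Q s x) \<and> (\<integral>s. Q s x \<partial>S) = x \<and>
          integrable S (\<lambda>s. (norm (Q s x - x))\<^sup>2) \<and>
          (\<integral>s. (norm (Q s x - x))\<^sup>2 \<partial>S) \<le> \<omega> * (norm x)\<^sup>2)"

definition expected_density ::
    "'s measure \<Rightarrow> ('s \<Rightarrow> real ^ 'd \<Rightarrow> real ^ 'd) \<Rightarrow> real" where
  "expected_density S Q = (SUP x. \<integral>s. real (l0_norm (Q s x)) \<partial>S)"

definition batch_diff ::
    "nat \<Rightarrow> (nat \<Rightarrow> nat \<Rightarrow> 'a::real_inner \<Rightarrow> real) \<Rightarrow> nat \<Rightarrow> nat set \<Rightarrow> 'a \<Rightarrow> 'a \<Rightarrow> 'a" where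
  "batch_diff b f i I x x' = (1 / real b) *\<^sub>R (\<Sum>j\<in>I. grad (f i j) x' - grad (f i j) x)"

(* The pair (x^k, g^k), for one realisation of the coins c k, of the minibatches I i k and of
   the quantization seeds \<xi> i k of worker i in iteration k. Minibatch and seed are not used
   when c k holds. *)
primrec vr_marina ::
    "nat \<Rightarrow> nat \<Rightarrow> nat \<Rightarrow> (nat \<Rightarrow> nat \<Rightarrow> 'a::real_inner \<Rightarrow> real) \<Rightarrow> ('s \<Rightarrow> 'a \<Rightarrow> 'a) \<Rightarrow>
     real \<Rightarrow> 'a \<Rightarrow> (nat \<Rightarrow> bool) \<Rightarrow> (nat \<Rightarrow> nat \<Rightarrow> nat set) \<Rightarrow> (nat \<Rightarrow> nat \<Rightarrow> 's) \<Rightarrow>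
     nat \<Rightarrow> 'a \<times> 'a" where
  "vr_marina n m b f Q \<gamma> x0 c I \<xi> 0 = (x0, grad (global_loss n m f) x0)"
| "vr_marina n m b f Q \<gamma> x0 c I \<xi> (Suc k) =
     (let (x, g) = vr_marina n m b f Q \<gamma> x0 c I \<xi> k;
          x' = x - \<gamma> *\<^sub>R g;
          g' = (\<lambda>i. if c k then grad (local_loss m f i) x'
                    else g + Q (\<xi> i k) (batch_diff b f i (I i k) x x'))
      in (x', (1 / real n) *\<^sub>R (\<Sum>i<n. g' i)))"

datatype source = Coin nat | Batch nat nat | Seed nat nat | Pick nat

definition source_events ::
    "'w measure \<Rightarrow> 's measure \<Rightarrow> (nat \<Rightarrow> 'w \<Rightarrow> bool) \<Rightarrow> (nat \<Rightarrow> nat \<Rightarrow> 'w \<Rightarrow> nat set) \<Rightarrow>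
     (nat \<Rightarrow> nat \<Rightarrow> 'w \<Rightarrow> 's) \<Rightarrow> (nat \<Rightarrow> 'w \<Rightarrow> nat) \<Rightarrow> source \<Rightarrow> 'w set set" where
  "source_events M S c I \<xi> pick r =
     (case r of
        Coin k \<Rightarrow> sets (vimage_algebra (space M) (c k) (count_space UNIV))
      | Batch i k \<Rightarrow> sets (vimage_algebra (space M) (I i k) (count_space UNIV))
      | Seed i k \<Rightarrow> sets (vimage_algebra (space M) (\<xi> i k) S)
      | Pick K \<Rightarrow> sets (vimage_algebra (space M) (pick K) (count_space UNIV)))"

(* The random inputs of the method, all drawn independently of each other. The law of a
   minibatch is constrained only by its size here. pick K is the uniformly random index of
   the iterate that is returned after K iterations. *)
definition vr_marina_inputs ::
    "'w measure \<Rightarrow> 's measure \<Rightarrow> nat \<Rightarrow> nat \<Rightarrow> nat \<Rightarrow> real \<Rightarrow> (nat \<Rightarrow> 'w \<Rightarrow> bool) \<Rightarrow>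
     (nat \<Rightarrow> nat \<Rightarrow> 'w \<Rightarrow> nat set) \<Rightarrow> (nat \<Rightarrow> nat \<Rightarrow> 'w \<Rightarrow> 's) \<Rightarrow> (nat \<Rightarrow> 'w \<Rightarrow> nat) \<Rightarrow> bool" where
  "vr_marina_inputs M S n m b p c I \<xi> pick \<longleftrightarrow>
     prob_space M \<and>
     (\<forall>k. c k \<in> measurable M (count_space UNIV) \<and>
          distr M (count_space UNIV) (c k) = measure_pmf (bernoulli_pmf p)) \<and>
     (\<forall>i<n. \<forall>k. I i k \<in> measurable M (count_space UNIV) \<and>
          (\<forall>w\<in>space M. I i k w \<subseteq> {..<m} \<and> card (I i k w) = b)) \<and>
     (\<forall>i<n. \<forall>k. \<xi> i k \<in> measurable M S \<and> distr M S (\<xi> i k) = S) \<and>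
     (\<forall>K\<ge>1. pick K \<in> measurable M (count_space UNIV) \<and>
          distr M (count_space UNIV) (pick K) = measure_pmf (pmf_of_set {..<K})) \<and>
     prob_space.indep_sets M (source_events M S c I \<xi> pick)
       (range Coin \<union> {Batch i k | i k. i < n} \<union> {Seed i k | i k. i < n} \<union> {Pick K | K. 1 \<le> K})"

(* X k is the k-th iterate, Dt i k the minibatch difference and D i k the exact one.
   The conditional expectation of a vector is taken componentwise. *)
definition average_smoothness ::
    "'w measure \<Rightarrow> nat \<Rightarrow> nat \<Rightarrow> (nat \<Rightarrow> real) \<Rightarrow> (nat \<Rightarrow> 'w \<Rightarrow> real ^ 'd) \<Rightarrow>
     (nat \<Rightarrow> nat \<Rightarrow> 'w \<Rightarrow> real ^ 'd) \<Rightarrow> (nat \<Rightarrow> nat \<Rightarrow> 'w \<Rightarrow> real ^ 'd) \<Rightarrow> bool" where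
  "average_smoothness M n b \<L> X D Dt \<longleftrightarrow>
     (\<forall>k. \<forall>i<n. 0 \<le> \<L> i \<and>
       (let F = vimage_algebra (space M) (\<lambda>w. (X k w, X (Suc k) w)) borel in
         (\<forall>l. AE w in M. real_cond_exp M F (\<lambda>w. Dt i k w $ l) w = D i k w $ l) \<and>
         (AE w in M. nn_cond_exp M F (\<lambda>w. ennreal ((norm (Dt i k w - D i k w))\<^sup>2)) w
            \<le> ennreal ((\<L> i)\<^sup>2 / real b * (norm (X (Suc k) w - X k w))\<^sup>2))))"

(* The component gradients computed by a worker, as pairs (j, t) for the gradient of f_ij at
   x^t: first all of them at x^0, then those of iteration k, for coin value ck and
   minibatch Ik. *)
definition initial_queries :: "nat \<Rightarrow> (nat \<times> nat) set" where
  "initial_queries m = {..<m} \<times> {0}"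

definition step_queries :: "nat \<Rightarrow> bool \<Rightarrow> nat set \<Rightarrow> nat \<Rightarrow> (nat \<times> nat) set" where
  "step_queries m ck Ik k = (if ck then {..<m} \<times> {Suc k} else Ik \<times> {k, Suc k})"

definition oracle_calls ::
    "nat \<Rightarrow> (nat \<Rightarrow> bool) \<Rightarrow> (nat \<Rightarrow> nat \<Rightarrow> nat set) \<Rightarrow> nat \<Rightarrow> nat \<Rightarrow> nat" where
  "oracle_calls m c I i K =
     card (initial_queries m) + (\<Sum>k<K. card (step_queries m (c k) (I i k) k))"

datatype 'a message = Dense 'a | Quantized 'a

(* The vectors sent by worker i to the server: the gradient of f_i at x^0 as message 0, and
   message k + 1 in iteration k. The argument xs is the sequence of iterates. *)
fun message_of ::
    "nat \<Rightarrow> nat \<Rightarrow> (nat \<Rightarrow> nat \<Rightarrow> 'a::real_inner \<Rightarrow> real) \<Rightarrow> ('s \<Rightarrow> 'a \<Rightarrow> 'a) \<Rightarrow>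
     (nat \<Rightarrow> 'a) \<Rightarrow> (nat \<Rightarrow> bool) \<Rightarrow> (nat \<Rightarrow> nat \<Rightarrow> nat set) \<Rightarrow> (nat \<Rightarrow> nat \<Rightarrow> 's) \<Rightarrow>
     nat \<Rightarrow> nat \<Rightarrow> 'a message" where
  "message_of m b f Q xs c I \<xi> i 0 = Dense (grad (local_loss m f i) (xs 0))"
| "message_of m b f Q xs c I \<xi> i (Suc k) =
     (if c k then Dense (grad (local_loss m f i) (xs (Suc k)))
      else Quantized (Q (\<xi> i k) (batch_diff b f i (I i k) (xs k) (xs (Suc k)))))"

fun nonzeros :: "(real ^ 'd) message \<Rightarrow> real" where
  "nonzeros (Dense v) = real (l0_norm v)"
| "nonzeros (Quantized v) = real (l0_norm v)"

(* Accounting cost: an unquantized vector is charged all its d components, a quantized one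
   the expected density z of the operator. The expected number of components which really
   are nonzero can be smaller, since z is a supremum and gradients may have zero entries. *)
fun charge :: "real \<Rightarrow> (real ^ 'd) message \<Rightarrow> real" where
  "charge z (Dense (v :: real ^ 'd)) = real CARD('d)"
| "charge z (Quantized v) = z"

end

theory Submission
  imports Defs
begin

text \<open>
  The gradient error \<open>a\<^sub>k = g\<^sup>k - \<nabla>f(x\<^sup>k)\<close> vanishes when the coin shows 1; otherwise
  \<open>a\<^sub>k\<^sub>+\<^sub>1 = a\<^sub>k + (1/n) \<Sum>\<^sub>i (q\<^sub>i + u\<^sub>i)\<close> with the quantization error \<open>q\<^sub>i\<close> and the minibatch error
  \<open>u\<^sub>i\<close> of worker \<open>i\<close>. All these summands are pairwise orthogonal in \<open>L\<^sup>2\<close>: a \<open>q\<^sub>i\<close> because its seed is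
  independent of everything else, a \<open>u\<^sub>i\<close> against functions of \<open>(x\<^sup>k, x\<^sup>k\<^sup>+\<^sup>1)\<close> by the conditional mean, and
  \<open>u\<^sub>i\<close> against \<open>u\<^sub>j\<close> by freezing the minibatch of \<open>j\<close>, which turns \<open>u\<^sub>j\<close> into such a function. Hence
  \<open>E\<parallel>a\<^sub>k\<^sub>+\<^sub>1\<parallel>\<^sup>2 \<le> (1 - p) (E\<parallel>a\<^sub>k\<parallel>\<^sup>2 + B E\<parallel>x\<^sup>k\<^sup>+\<^sup>1 - x\<^sup>k\<parallel>\<^sup>2)\<close> with
  \<open>B = (\<omega> L\<^sup>2 + (1 + \<omega>) \<L>\<^sup>2 / b') / n\<close>, and by the descent lemma \<open>f(x\<^sup>k) - f\<^sub>* + \<gamma>/(2p) \<parallel>a\<^sub>k\<parallel>\<^sup>2\<close>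
  decreases in expectation by at least \<open>\<gamma>/2 E\<parallel>\<nabla>f(x\<^sup>k)\<parallel>\<^sup>2\<close> in each step.
\<close>

text \<open>The minibatch assumption conditions on x^k and x^(k+1) alone, neither on the whole
  history nor on the other workers. This shapes the treatment of the u_i: the old error a_k
  qualifies as a test function only because the direction can be read off the two iterates, while
  the u_j of another worker does not qualify and needs a detour through the independence of the
  minibatches. No moment of an iterate is assumed either. Second moments are obtained by induction
  along the run, and the bounds for q_i and u_i are first derived for nonnegative integrals, where
  finiteness is a conclusion, before expectations of inner products are formed. Independence is
  never argued event by event: each random quantity is assigned a set of coins, minibatches and
  seeds that determine it, and quantities with disjoint sets are independent.\<close>

section \<open>Gradients: existence, measurability, descent inequality\<close>

lemma GDERIV_unique:
  assumes "GDERIV h x :> D" "GDERIV h x :> D'"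
  shows "D = D'"
proof -
  have "(\<lambda>v. inner v D) = (\<lambda>v. inner v D')"
    using assms unfolding gderiv_def by (rule has_derivative_unique)
  then have "inner (D - D') D = inner (D - D') D'"
    by (rule fun_cong)
  then have "inner (D - D') (D - D') = 0"
    by (simp add: inner_diff_right)
  then show ?thesis by simp
qed

lemma grad_eqI: "GDERIV h x :> D \<Longrightarrow> grad h x = D"
  unfolding grad_def by (rule the_equality) (auto dest: GDERIV_unique)

text \<open>\<open>grad\<close> is a definite description, so its use rests on existence: the
  derivative is a linear functional, represented by the vector of its values on the basis.\<close>

lemma GDERIV_grad:
  fixes h :: "'a::euclidean_space \<Rightarrow> real"
  assumes "h differentiable (at x)"
  shows "GDERIV h x :> grad h x"
proof -
  obtain h' where h': "(h has_derivative h') (at x)"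
    using assms by (auto simp: differentiable_def)
  then interpret bounded_linear h' by (rule has_derivative_bounded_linear)
  have "h' = (\<lambda>v. inner v (\<Sum>e\<in>Basis. h' e *\<^sub>R e))"
  proof
    fix v
    have "h' v = h' (\<Sum>e\<in>Basis. inner v e *\<^sub>R e)"
      by (simp add: euclidean_representation)
    also have "\<dots> = inner v (\<Sum>e\<in>Basis. h' e *\<^sub>R e)"
      by (simp add: sum scaleR inner_sum_right mult.commute)
    finally show "h' v = inner v (\<Sum>e\<in>Basis. h' e *\<^sub>R e)" .
  qed
  with h' have "GDERIV h x :> (\<Sum>e\<in>Basis. h' e *\<^sub>R e)"
    unfolding gderiv_def by simp
  then show ?thesis by (simp add: grad_eqI)
qed

lemma grad_scaled_sum:
  fixes h :: "nat \<Rightarrow> 'a::euclidean_space \<Rightarrow> real"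
  assumes "\<And>j. j < k \<Longrightarrow> h j differentiable (at x)"
  shows "grad (\<lambda>y. a * (\<Sum>j<k. h j y)) x = a *\<^sub>R (\<Sum>j<k. grad (h j) x)"
proof (rule grad_eqI)
  have "((\<lambda>y. a * (\<Sum>j<k. h j y)) has_derivative (\<lambda>v. a * (\<Sum>j<k. inner v (grad (h j) x)))) (at x)"
    using assms GDERIV_grad[unfolded gderiv_def]
    by (intro has_derivative_mult_right has_derivative_sum) auto
  then show "GDERIV (\<lambda>y. a * (\<Sum>j<k. h j y)) x :> a *\<^sub>R (\<Sum>j<k. grad (h j) x)"
    by (simp add: gderiv_def inner_sum_right)
qed

text \<open>The single \<open>f i j\<close> are only differentiable, so their gradients may be
  discontinuous. Each component is still a pointwise limit of difference quotients of a continuous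
  function.\<close>

lemma borel_measurable_grad:
  fixes h :: "'a::euclidean_space \<Rightarrow> real"
  assumes diff: "\<And>x. h differentiable (at x)"
  shows "grad h \<in> borel_measurable borel"
proof (subst borel_measurable_euclidean_space, intro ballI)
  fix e :: 'a assume e: "e \<in> Basis"
  have "continuous_on UNIV h"
    using diff by (simp add: continuous_at_imp_continuous_on differentiable_imp_continuous_within)
  then have [measurable]: "h \<in> borel_measurable borel"
    by (rule borel_measurable_continuous_onI)
  show "(\<lambda>x. inner (grad h x) e) \<in> borel_measurable borel"
  proof (rule borel_measurable_LIMSEQ_real)
    fix x
    have "((\<lambda>t. h (x + t *\<^sub>R e)) has_derivative (\<lambda>s. inner (s *\<^sub>R e) (grad h x))) (at 0)"
    proof (rule has_derivative_compose[of "\<lambda>t. x + t *\<^sub>R e" "\<lambda>s. s *\<^sub>R e" 0 UNIV h, simplified])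
      show "((\<lambda>t. x + t *\<^sub>R e) has_derivative (\<lambda>s. s *\<^sub>R e)) (at 0)"
        by (auto intro!: derivative_eq_intros)
      show "(h has_derivative (\<lambda>v. inner v (grad h x))) (at x)"
        using GDERIV_grad[OF diff] by (simp add: gderiv_def)
    qed
    then have "((\<lambda>t. h (x + t *\<^sub>R e)) has_field_derivative inner (grad h x) e) (at 0)"
      unfolding has_field_derivative_def
      by (rule has_derivative_eq_rhs) (auto simp: inner_commute)
    then have "((\<lambda>t. (h (x + t *\<^sub>R e) - h x) / t) \<longlongrightarrow> inner (grad h x) e) (at 0)"
      by (simp add: DERIV_def)
    moreover have "filterlim (\<lambda>k. 1 / real (Suc k)) (at 0) sequentially"
      by (rule filterlim_atI[OF lim_1_over_n[THEN LIMSEQ_Suc]]) auto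
    ultimately show "(\<lambda>k. (h (x + (1 / real (Suc k)) *\<^sub>R e) - h x) / (1 / real (Suc k)))
        \<longlonglongrightarrow> inner (grad h x) e"
      by (rule filterlim_compose)
  qed measurable
qed

lemma smooth_with_descent:
  fixes h :: "'a::euclidean_space \<Rightarrow> real"
  assumes diff: "\<And>x. h differentiable (at x)" and L: "smooth_with L h"
  shows "h y \<le> h x + inner (grad h x) (y - x) + L / 2 * (norm (y - x))\<^sup>2"
proof -
  \<comment> \<open>The difference \<open>\<phi> t - \<phi> 0\<close> is the amount by which the
    inequality fails at \<open>x + t *\<^sub>R (y - x)\<close>. Smoothness makes \<phi>
    nonincreasing for t \<ge> 0.\<close>
  define \<phi> where "\<phi> t = h (x + t *\<^sub>R (y - x)) - t * inner (grad h x) (y - x)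
      - L / 2 * t\<^sup>2 * (norm (y - x))\<^sup>2" for t :: real
  define \<phi>' where "\<phi>' t = inner (grad h (x + t *\<^sub>R (y - x))) (y - x) - inner (grad h x) (y - x)
      - L * t * (norm (y - x))\<^sup>2" for t :: real
  have "(\<phi> has_field_derivative \<phi>' t) (at t)" for t
  proof -
    have "((\<lambda>t. h (x + t *\<^sub>R (y - x))) has_derivative
        (\<lambda>s. inner (s *\<^sub>R (y - x)) (grad h (x + t *\<^sub>R (y - x))))) (at t)"
    proof (rule has_derivative_compose[of "\<lambda>t. x + t *\<^sub>R (y - x)" "\<lambda>s. s *\<^sub>R (y - x)" t UNIV h, simplified])
      show "((\<lambda>t. x + t *\<^sub>R (y - x)) has_derivative (\<lambda>s. s *\<^sub>R (y - x))) (at t)"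
        by (auto intro!: derivative_eq_intros)
      show "(h has_derivative (\<lambda>v. inner v (grad h (x + t *\<^sub>R (y - x))))) (at (x + t *\<^sub>R (y - x)))"
        using GDERIV_grad[OF diff] by (simp add: gderiv_def)
    qed
    then have "((\<lambda>t. h (x + t *\<^sub>R (y - x))) has_field_derivative
        inner (grad h (x + t *\<^sub>R (y - x))) (y - x)) (at t)"
      unfolding has_field_derivative_def
      by (rule has_derivative_eq_rhs) (auto simp: inner_commute)
    then show ?thesis
      unfolding \<phi>_def[abs_def] \<phi>'_def by (auto intro!: derivative_eq_intros)
  qed
  moreover have "\<phi>' t \<le> 0" if "0 \<le> t" for t
  proof -
    have "inner (grad h (x + t *\<^sub>R (y - x)) - grad h x) (y - x)
        \<le> norm (grad h (x + t *\<^sub>R (y - x)) - grad h x) * norm (y - x)"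
      by (rule norm_cauchy_schwarz)
    also have "\<dots> \<le> (L * norm (x + t *\<^sub>R (y - x) - x)) * norm (y - x)"
      using L[unfolded smooth_with_def, rule_format, of "x + t *\<^sub>R (y - x)" x]
      by (intro mult_right_mono) (auto simp del: add_diff_cancel_left')
    also have "\<dots> = L * t * (norm (y - x))\<^sup>2"
      using that by (simp add: power2_eq_square)
    finally show ?thesis by (simp add: \<phi>'_def inner_diff_left)
  qed
  ultimately have "\<phi> 1 \<le> \<phi> 0"
    by (intro DERIV_nonpos_imp_nonincreasing[of 0 1 \<phi>]) auto
  then show ?thesis by (simp add: \<phi>_def)
qed

text \<open>Serves the degenerate case \<open>A = 0\<close> of the theorem. For smoothness constant
  0 the descent bound is affine, so a nonzero gradient would allow a move below any lower
  bound.\<close>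

lemma grad_eq_0_if_flat_bounded_below:
  fixes h :: "'a::euclidean_space \<Rightarrow> real"
  assumes diff: "\<And>x. h differentiable (at x)" and flat: "smooth_with 0 h"
    and below: "\<And>x. c \<le> h x"
  shows "grad h x = 0"
proof (rule ccontr)
  assume "grad h x \<noteq> 0"
  then have pos: "(norm (grad h x))\<^sup>2 > 0" by simp
  \<comment> \<open>The solution of
    \<open>h x - t * (norm (grad h x))\<^sup>2 = c - 1\<close>.\<close>
  define t where "t = (h x - c + 1) / (norm (grad h x))\<^sup>2"
  have "h (x - t *\<^sub>R grad h x) \<le> h x - t * (norm (grad h x))\<^sup>2"
    using smooth_with_descent[OF diff flat, of "x - t *\<^sub>R grad h x" x]
    by (simp add: power2_norm_eq_inner)
  also have "\<dots> = c - 1" using pos by (simp add: t_def)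
  finally show False using below[of "x - t *\<^sub>R grad h x"] by simp
qed

text \<open>The stepsize condition enters only through the nonnegativity of the coefficient of
  \<open>\<parallel>x - x'\<parallel>\<^sup>2\<close> in the one-step decrease of the Lyapunov function.\<close>

lemma stepsize_coefficient_nonneg:
  fixes L C \<gamma> :: real
  assumes "0 < \<gamma>" "0 \<le> L" "0 \<le> C" and le: "\<gamma> * (L + sqrt C) \<le> 1"
  shows "0 \<le> 1 / \<gamma> - L - \<gamma> * C"
proof -
  define s where "s = sqrt C"
  have s: "0 \<le> s" "s\<^sup>2 = C" using assms by (auto simp: s_def)
  have "0 \<le> \<gamma> * s" "0 \<le> \<gamma> * L" "\<gamma> * L + \<gamma> * s \<le> 1"
    using assms s by (auto simp: s_def algebra_simps)
  \<comment> \<open>As \<gamma> s is at most 1, its square is at most itself; this trades the square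
    root in the condition for \<open>C\<close>.\<close>
  then have "(\<gamma> * s) * (\<gamma> * s) \<le> (\<gamma> * s) * 1"
    by (intro mult_left_mono) linarith+
  also have "\<dots> \<le> 1 - \<gamma> * L"
    using \<open>\<gamma> * L + \<gamma> * s \<le> 1\<close> by linarith
  finally have "\<gamma> * (\<gamma> * C) \<le> 1 - \<gamma> * L"
    by (simp flip: s(2) add: power2_eq_square mult_ac)
  then show ?thesis
    using \<open>0 < \<gamma>\<close> by (simp add: field_simps)
qed

text \<open>Polarization turns \<open>- \<gamma> * inner (grad h x) g\<close> into the squared norms
  of gradient, direction and their difference. Since x' - x = - \<gamma> g, the direction's part
  merges with the quadratic term of the descent inequality.\<close>

lemma lyapunov_decrease:
  fixes h :: "'a::euclidean_space \<Rightarrow> real"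
  assumes diff: "\<And>x. h differentiable (at x)" and L: "smooth_with L h" and "0 < \<gamma>"
    and x': "x' = x - \<gamma> *\<^sub>R g"
  shows "h x' \<le> h x - \<gamma> / 2 * (norm (grad h x))\<^sup>2
      - (1 / (2 * \<gamma>) - L / 2) * (norm (x' - x))\<^sup>2 + \<gamma> / 2 * (norm (g - grad h x))\<^sup>2"
proof -
  have n: "(norm (x' - x))\<^sup>2 = \<gamma>\<^sup>2 * (norm g)\<^sup>2"
    by (simp add: x' power_mult_distrib)
  have "1 / (2 * \<gamma>) * (norm (x' - x))\<^sup>2 = \<gamma> / 2 * (norm g)\<^sup>2"
    unfolding n using \<open>0 < \<gamma>\<close> by (simp add: power2_eq_square field_simps)
  moreover have "\<gamma> / 2 * (norm (g - grad h x))\<^sup>2 =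
      \<gamma> / 2 * (norm g)\<^sup>2 - \<gamma> * inner (grad h x) g + \<gamma> / 2 * (norm (grad h x))\<^sup>2"
    by (simp add: power2_norm_eq_inner inner_diff_left inner_diff_right inner_commute algebra_simps)
  moreover have "inner (grad h x) (x' - x) = - (\<gamma> * inner (grad h x) g)"
    by (simp add: x')
  ultimately show ?thesis
    using smooth_with_descent[OF diff L, of x' x] by (simp add: algebra_simps)
qed

section \<open>Square integrable vectors and orthogonality\<close>

definition sq_integrable :: "'w measure \<Rightarrow> ('w \<Rightarrow> 'a::euclidean_space) \<Rightarrow> bool" where
  "sq_integrable M V \<longleftrightarrow> V \<in> borel_measurable M \<and> integrable M (\<lambda>w. (norm (V w))\<^sup>2)"

lemma sq_integrableI:
  "V \<in> borel_measurable M \<Longrightarrow> integrable M (\<lambda>w. (norm (V w))\<^sup>2) \<Longrightarrow> sq_integrable M V"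
  by (simp add: sq_integrable_def)

lemma sq_integrableD:
  assumes "sq_integrable M V"
  shows "V \<in> borel_measurable M" "integrable M (\<lambda>w. (norm (V w))\<^sup>2)"
  using assms by (auto simp: sq_integrable_def)

lemma sq_integrable_scaleR: "sq_integrable M V \<Longrightarrow> sq_integrable M (\<lambda>w. a *\<^sub>R V w)"
  by (auto simp: sq_integrable_def power_mult_distrib)

lemma norm_add_sq_le: "(norm (v + w))\<^sup>2 \<le> 2 * (norm v)\<^sup>2 + 2 * (norm w)\<^sup>2" for v w :: "'a::real_inner"
proof -
  have "(norm (v + w))\<^sup>2 + (norm (v - w))\<^sup>2 = 2 * (norm v)\<^sup>2 + 2 * (norm w)\<^sup>2"
    by (simp add: power2_norm_eq_inner inner_add_left inner_add_right inner_diff_left inner_diff_right)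
  then show ?thesis using zero_le_power2[of "norm (v - w)"] by linarith
qed

lemma sq_integrable_add:
  assumes V: "sq_integrable M V" and W: "sq_integrable M W"
  shows "sq_integrable M (\<lambda>w. V w + W w)"
proof (rule sq_integrableI)
  note [measurable] = sq_integrableD(1)[OF V] sq_integrableD(1)[OF W]
  show "(\<lambda>w. V w + W w) \<in> borel_measurable M" by measurable
  show "integrable M (\<lambda>w. (norm (V w + W w))\<^sup>2)"
  proof (rule Bochner_Integration.integrable_bound)
    show "integrable M (\<lambda>w. 2 * (norm (V w))\<^sup>2 + 2 * (norm (W w))\<^sup>2)"
      using sq_integrableD(2)[OF V] sq_integrableD(2)[OF W] by simp
    show "AE w in M. norm ((norm (V w + W w))\<^sup>2) \<le> norm (2 * (norm (V w))\<^sup>2 + 2 * (norm (W w))\<^sup>2)"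
      by (rule AE_I2) (simp add: norm_add_sq_le)
  qed measurable
qed

lemma sq_integrable_diff:
  "sq_integrable M V \<Longrightarrow> sq_integrable M W \<Longrightarrow> sq_integrable M (\<lambda>w. V w - W w)"
  using sq_integrable_add[OF _ sq_integrable_scaleR[of M W "-1"], of V] by simp

lemma sq_integrable_sum:
  assumes "\<And>i. i \<in> T \<Longrightarrow> sq_integrable M (V i)"
  shows "sq_integrable M (\<lambda>w. \<Sum>i\<in>T. V i w)"
  using assms
proof (induction T rule: infinite_finite_induct)
  case (insert i T)
  then have "sq_integrable M (\<lambda>w. V i w + (\<Sum>i\<in>T. V i w))"
    by (intro sq_integrable_add) auto
  with insert.hyps show ?case by simp
qed (auto simp: sq_integrable_def)

lemma sq_integrable_bound:
  assumes W: "sq_integrable M W" and V: "V \<in> borel_measurable M"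
    and le: "\<And>w. w \<in> space M \<Longrightarrow> norm (V w) \<le> C * norm (W w)"
  shows "sq_integrable M V"
proof (rule sq_integrableI[OF V])
  show "integrable M (\<lambda>w. (norm (V w))\<^sup>2)"
  proof (rule Bochner_Integration.integrable_bound)
    show "integrable M (\<lambda>w. C\<^sup>2 * (norm (W w))\<^sup>2)"
      using sq_integrableD(2)[OF W] by simp
    show "(\<lambda>w. (norm (V w))\<^sup>2) \<in> borel_measurable M"
      using V by measurable
    have "(norm (V w))\<^sup>2 \<le> C\<^sup>2 * (norm (W w))\<^sup>2" if "w \<in> space M" for w
      using power_mono[OF le[OF that], of 2] by (simp add: power_mult_distrib)
    then show "AE w in M. norm ((norm (V w))\<^sup>2) \<le> norm (C\<^sup>2 * (norm (W w))\<^sup>2)"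
      by (intro AE_I2) simp
  qed
qed

lemma sq_integrable_inner:
  assumes V: "sq_integrable M V" and W: "sq_integrable M W"
  shows "integrable M (\<lambda>w. inner (V w) (W w))"
proof (rule Bochner_Integration.integrable_bound
    [of _ "\<lambda>w. (norm (V w))\<^sup>2 + (norm (W w))\<^sup>2"])
  show "integrable M (\<lambda>w. (norm (V w))\<^sup>2 + (norm (W w))\<^sup>2)"
    using sq_integrableD(2)[OF V] sq_integrableD(2)[OF W] by simp
  note [measurable] = sq_integrableD(1)[OF V] sq_integrableD(1)[OF W]
  show "(\<lambda>w. inner (V w) (W w)) \<in> borel_measurable M" by measurable
  have "\<bar>inner v w\<bar> \<le> (norm v)\<^sup>2 + (norm w)\<^sup>2" for v w :: 'b
  proof -
    have "\<bar>inner v w\<bar> \<le> norm v * norm w" by (rule Cauchy_Schwarz_ineq2)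
    moreover have "2 * (norm v * norm w) \<le> (norm v)\<^sup>2 + (norm w)\<^sup>2"
      using sum_squares_bound[of "norm v" "norm w"] by simp
    moreover have "0 \<le> norm v * norm w" by simp
    ultimately show ?thesis by linarith
  qed
  then show "AE w in M. norm (inner (V w) (W w)) \<le> norm ((norm (V w))\<^sup>2 + (norm (W w))\<^sup>2)"
    by auto
qed

lemma pythagoras_integral:
  assumes V: "sq_integrable M V" and W: "sq_integrable M W"
    and orth: "(\<integral>w. inner (V w) (W w) \<partial>M) = 0"
  shows "(\<integral>w. (norm (V w + W w))\<^sup>2 \<partial>M) = (\<integral>w. (norm (V w))\<^sup>2 \<partial>M) + (\<integral>w. (norm (W w))\<^sup>2 \<partial>M)"
proof -
  have "(norm (v + w))\<^sup>2 = (norm v)\<^sup>2 + (norm w)\<^sup>2 + 2 * inner v w" for v w :: 'b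
    by (simp add: power2_norm_eq_inner inner_add_left inner_add_right inner_commute)
  then have "(\<integral>w. (norm (V w + W w))\<^sup>2 \<partial>M)
      = (\<integral>w. (norm (V w))\<^sup>2 + (norm (W w))\<^sup>2 + 2 * inner (V w) (W w) \<partial>M)"
    by (intro Bochner_Integration.integral_cong refl)
  then show ?thesis
    using sq_integrableD(2)[OF V] sq_integrableD(2)[OF W] sq_integrable_inner[OF V W] orth
    by simp
qed

lemma orthogonal_sum_integral:
  assumes V: "\<And>i. i \<in> T \<Longrightarrow> sq_integrable M (V i)" and W: "sq_integrable M W"
    and orth: "\<And>i. i \<in> T \<Longrightarrow> (\<integral>w. inner (W w) (V i w) \<partial>M) = 0"
  shows "(\<integral>w. inner (W w) (\<Sum>i\<in>T. V i w) \<partial>M) = 0"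
  using sq_integrable_inner[OF W V] orth by (simp add: inner_sum_right)

lemma pythagoras_sum_integral:
  assumes "finite T" and "\<And>i. i \<in> T \<Longrightarrow> sq_integrable M (V i)"
    and "\<And>i j. i \<in> T \<Longrightarrow> j \<in> T \<Longrightarrow> i \<noteq> j \<Longrightarrow> (\<integral>w. inner (V i w) (V j w) \<partial>M) = 0"
  shows "(\<integral>w. (norm (\<Sum>i\<in>T. V i w))\<^sup>2 \<partial>M) = (\<Sum>i\<in>T. \<integral>w. (norm (V i w))\<^sup>2 \<partial>M)"
  using assms
proof (induction T rule: finite_induct)
  case (insert i T)
  have "(\<integral>w. inner (V i w) (\<Sum>j\<in>T. V j w) \<partial>M) = 0"
    using insert.prems insert.hyps by (intro orthogonal_sum_integral) auto
  then have "(\<integral>w. (norm (V i w + (\<Sum>j\<in>T. V j w)))\<^sup>2 \<partial>M)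
      = (\<integral>w. (norm (V i w))\<^sup>2 \<partial>M) + (\<integral>w. (norm (\<Sum>j\<in>T. V j w))\<^sup>2 \<partial>M)"
    using insert.prems by (intro pythagoras_integral sq_integrable_sum) auto
  with insert show ?case by simp
qed simp

section \<open>Independent variables and iterated integrals\<close>

context prob_space
begin

text \<open>The library's \<open>indep_var\<close> forces both variables to have the same codomain type.\<close>

definition indep_rv :: "'b measure \<Rightarrow> ('a \<Rightarrow> 'b) \<Rightarrow> 'c measure \<Rightarrow> ('a \<Rightarrow> 'c) \<Rightarrow> bool" where
  "indep_rv N V N' W \<longleftrightarrow> V \<in> measurable M N \<and> W \<in> measurable M N' \<and>
     (\<forall>A\<in>sets N. \<forall>B\<in>sets N'. prob ((V -` A \<inter> space M) \<inter> (W -` B \<inter> space M))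
        = prob (V -` A \<inter> space M) * prob (W -` B \<inter> space M))"

lemma indep_rv_rv1: "indep_rv N V N' W \<Longrightarrow> V \<in> measurable M N"
  and indep_rv_rv2: "indep_rv N V N' W \<Longrightarrow> W \<in> measurable M N'"
  by (auto simp: indep_rv_def)

lemma indep_rv_compose1:
  assumes ind: "indep_rv N V N' W" and f: "f \<in> measurable N L"
  shows "indep_rv L (\<lambda>w. f (V w)) N' W"
proof -
  have V: "V \<in> measurable M N" using ind by (rule indep_rv_rv1)
  have *: "(\<lambda>w. f (V w)) -` A \<inter> space M = V -` (f -` A \<inter> space N) \<inter> space M" for A
    using measurable_space[OF V] by auto
  show ?thesis
    unfolding indep_rv_def
  proof (intro conjI ballI)
    fix A B assume "A \<in> sets L" "B \<in> sets N'"
    then show "prob (((\<lambda>w. f (V w)) -` A \<inter> space M) \<inter> (W -` B \<inter> space M))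
        = prob ((\<lambda>w. f (V w)) -` A \<inter> space M) * prob (W -` B \<inter> space M)"
      unfolding * using ind measurable_sets[OF f] unfolding indep_rv_def by blast
  qed (use measurable_compose[OF V f] indep_rv_rv2[OF ind] in auto)
qed

lemma indep_rv_joint_distr:
  assumes ind: "indep_rv N V N' W"
  shows "distr M N V \<Otimes>\<^sub>M distr M N' W = distr M (N \<Otimes>\<^sub>M N') (\<lambda>w. (V w, W w))"
proof -
  have [measurable]: "V \<in> measurable M N" "W \<in> measurable M N'"
    using ind by (auto dest: indep_rv_rv1 indep_rv_rv2)
  interpret V: prob_space "distr M N V" by (rule prob_space_distr) measurable
  interpret W: prob_space "distr M N' W" by (rule prob_space_distr) measurable
  show ?thesis
  proof (rule pair_measure_eqI)
    fix A B assume A: "A \<in> sets (distr M N V)" and B: "B \<in> sets (distr M N' W)"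
    have "(\<lambda>w. (V w, W w)) -` (A \<times> B) \<inter> space M = (V -` A \<inter> space M) \<inter> (W -` B \<inter> space M)"
      by auto
    moreover have "prob ((V -` A \<inter> space M) \<inter> (W -` B \<inter> space M))
        = prob (V -` A \<inter> space M) * prob (W -` B \<inter> space M)"
      using ind A B by (auto simp: indep_rv_def)
    ultimately show "emeasure (distr M N V) A * emeasure (distr M N' W) B
        = emeasure (distr M (N \<Otimes>\<^sub>M N') (\<lambda>w. (V w, W w))) (A \<times> B)"
      using A B by (simp add: emeasure_distr emeasure_eq_measure ennreal_mult')
  qed (simp_all add: V.sigma_finite_measure_axioms W.sigma_finite_measure_axioms)
qed

text \<open>The joint law is a product, so Tonelli applies. This version is for bounds from which
  integrability is still to be derived.\<close>

lemma indep_rv_nn_integral_iterated: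
  assumes ind: "indep_rv N V N' W" and h: "h \<in> borel_measurable (N \<Otimes>\<^sub>M N')"
  shows "(\<integral>\<^sup>+ w. h (V w, W w) \<partial>M) = (\<integral>\<^sup>+ w. (\<integral>\<^sup>+ s. h (V w, s) \<partial>distr M N' W) \<partial>M)"
proof -
  have [measurable]: "V \<in> measurable M N" "W \<in> measurable M N'"
    using ind by (auto dest: indep_rv_rv1 indep_rv_rv2)
  note [measurable] = h
  interpret W: prob_space "distr M N' W" by (rule prob_space_distr) measurable
  have eq: "distr M N V \<Otimes>\<^sub>M distr M N' W = distr M (N \<Otimes>\<^sub>M N') (\<lambda>w. (V w, W w))"
    by (rule indep_rv_joint_distr[OF ind])
  have "(\<integral>\<^sup>+ w. h (V w, W w) \<partial>M) = (\<integral>\<^sup>+ z. h z \<partial>(distr M N V \<Otimes>\<^sub>M distr M N' W))"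
    unfolding eq by (subst nn_integral_distr) auto
  also have "\<dots> = (\<integral>\<^sup>+ v. (\<integral>\<^sup>+ s. h (v, s) \<partial>distr M N' W) \<partial>distr M N V)"
    by (subst W.nn_integral_fst) auto
  also have "\<dots> = (\<integral>\<^sup>+ w. (\<integral>\<^sup>+ s. h (V w, s) \<partial>distr M N' W) \<partial>M)"
    by (subst nn_integral_distr) auto
  finally show ?thesis .
qed

text \<open>Replaces conditioning on \<open>V\<close>: freeze its value and average over
  \<open>W\<close>. The second claim provides integrability for almost every frozen value in places
  where no pointwise bound is at hand.\<close>

lemma indep_rv_integral_iterated:
  fixes h :: "_ \<Rightarrow> real"
  assumes ind: "indep_rv N V N' W" and h: "h \<in> borel_measurable (N \<Otimes>\<^sub>M N')"
    and int: "integrable M (\<lambda>w. h (V w, W w))"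
  shows "(\<integral>w. h (V w, W w) \<partial>M) = (\<integral>w. (\<integral>s. h (V w, s) \<partial>distr M N' W) \<partial>M)"
    and "AE w in M. integrable (distr M N' W) (\<lambda>s. h (V w, s))"
    and "integrable M (\<lambda>w. \<integral>s. h (V w, s) \<partial>distr M N' W)"
proof -
  have [measurable]: "V \<in> measurable M N" "W \<in> measurable M N'"
    using ind by (auto dest: indep_rv_rv1 indep_rv_rv2)
  note [measurable] = h
  interpret V: prob_space "distr M N V" by (rule prob_space_distr) measurable
  interpret W: prob_space "distr M N' W" by (rule prob_space_distr) measurable
  interpret VW: pair_sigma_finite "distr M N V" "distr M N' W" ..
  have eq: "distr M N V \<Otimes>\<^sub>M distr M N' W = distr M (N \<Otimes>\<^sub>M N') (\<lambda>w. (V w, W w))"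
    by (rule indep_rv_joint_distr[OF ind])
  have int': "integrable (distr M N V \<Otimes>\<^sub>M distr M N' W) h"
    unfolding eq using int by (subst integrable_distr_eq) auto
  have "(\<integral>w. h (V w, W w) \<partial>M) = (\<integral>z. h z \<partial>(distr M N V \<Otimes>\<^sub>M distr M N' W))"
    unfolding eq by (subst integral_distr) auto
  also have "\<dots> = (\<integral>v. (\<integral>s. h (v, s) \<partial>distr M N' W) \<partial>distr M N V)"
    by (rule VW.integral_fst'[OF int', symmetric])
  also have "\<dots> = (\<integral>w. (\<integral>s. h (V w, s) \<partial>distr M N' W) \<partial>M)"
    by (subst integral_distr) auto
  finally show "(\<integral>w. h (V w, W w) \<partial>M) = (\<integral>w. (\<integral>s. h (V w, s) \<partial>distr M N' W) \<partial>M)" .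
  show "AE w in M. integrable (distr M N' W) (\<lambda>s. h (V w, s))"
    using VW.AE_integrable_fst'[OF int'] by (subst (asm) AE_distr_iff) auto
  show "integrable M (\<lambda>w. \<integral>s. h (V w, s) \<partial>distr M N' W)"
    using VW.integrable_fst'[OF int'] by (subst (asm) integrable_distr_eq) auto
qed

section \<open>Quantization errors and independent indicators\<close>

lemma quantization_measurable:
  assumes "quantization_operator S Q \<omega>" "s \<in> measurable N S" "v \<in> borel_measurable N"
  shows "(\<lambda>w. Q (s w) (v w)) \<in> borel_measurable N"
  using measurable_compose[OF measurable_Pair[OF assms(2,3)], of "\<lambda>(s, x). Q s x" borel] assms(1)
  by (simp add: quantization_operator_def)

text \<open>The seed has law \<open>S\<close> and is independent of the argument. Once the argument
  is frozen, the variance bound of the operator applies pointwise.\<close>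

lemma quantization_error_sq:
  assumes Q: "quantization_operator S Q \<omega>" and distr: "distr M S \<xi> = S"
    and ind: "indep_rv borel V S \<xi>" and V: "sq_integrable M V"
  shows "sq_integrable M (\<lambda>w. Q (\<xi> w) (V w) - V w)"
    and "(\<integral>w. (norm (Q (\<xi> w) (V w) - V w))\<^sup>2 \<partial>M) \<le> \<omega> * (\<integral>w. (norm (V w))\<^sup>2 \<partial>M)"
proof -
  have [measurable]: "V \<in> borel_measurable M" "\<xi> \<in> measurable M S"
    using ind by (auto dest: indep_rv_rv1 indep_rv_rv2)
  have "0 < \<omega>" using Q by (simp add: quantization_operator_def)
  have [measurable]: "(\<lambda>w. Q (\<xi> w) (V w)) \<in> borel_measurable M"
    by (rule quantization_measurable[OF Q]) measurable
  have [measurable]: "(\<lambda>z. Q (snd z) (fst z)) \<in> borel_measurable (borel \<Otimes>\<^sub>M S)"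
    by (rule quantization_measurable[OF Q]) measurable
  have hm: "(\<lambda>z. ennreal ((norm (Q (snd z) (fst z) - fst z))\<^sup>2)) \<in> borel_measurable (borel \<Otimes>\<^sub>M S)"
    by measurable
  have "(\<integral>\<^sup>+ w. (norm (Q (\<xi> w) (V w) - V w))\<^sup>2 \<partial>M)
      = (\<integral>\<^sup>+ w. (\<integral>\<^sup>+ s. (norm (Q s (V w) - V w))\<^sup>2 \<partial>S) \<partial>M)"
    using indep_rv_nn_integral_iterated[OF ind hm] by (simp add: distr)
  also have "\<dots> \<le> (\<integral>\<^sup>+ w. ennreal (\<omega> * (norm (V w))\<^sup>2) \<partial>M)"
  proof (rule nn_integral_mono)
    fix w
    have "(\<integral>\<^sup>+ s. (norm (Q s (V w) - V w))\<^sup>2 \<partial>S) = ennreal (\<integral>s. (norm (Q s (V w) - V w))\<^sup>2 \<partial>S)"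
      using Q by (intro nn_integral_eq_integral) (auto simp: quantization_operator_def)
    also have "\<dots> \<le> ennreal (\<omega> * (norm (V w))\<^sup>2)"
      using Q by (intro ennreal_leI) (auto simp: quantization_operator_def)
    finally show "(\<integral>\<^sup>+ s. (norm (Q s (V w) - V w))\<^sup>2 \<partial>S) \<le> ennreal (\<omega> * (norm (V w))\<^sup>2)" .
  qed
  also have "\<dots> = ennreal (\<omega> * (\<integral>w. (norm (V w))\<^sup>2 \<partial>M))"
    using sq_integrableD(2)[OF V] \<open>0 < \<omega>\<close> by (subst nn_integral_eq_integral) auto
  finally have le: "(\<integral>\<^sup>+ w. (norm (Q (\<xi> w) (V w) - V w))\<^sup>2 \<partial>M) \<le> ennreal (\<omega> * (\<integral>w. (norm (V w))\<^sup>2 \<partial>M))" .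
  have int: "integrable M (\<lambda>w. (norm (Q (\<xi> w) (V w) - V w))\<^sup>2)"
  proof (rule integrableI_bounded)
    show "(\<integral>\<^sup>+ w. norm ((norm (Q (\<xi> w) (V w) - V w))\<^sup>2) \<partial>M) < \<infinity>"
      using le_less_trans[OF le ennreal_less_top] by simp
  qed measurable
  then show "sq_integrable M (\<lambda>w. Q (\<xi> w) (V w) - V w)"
    by (intro sq_integrableI) measurable
  have "0 \<le> \<omega> * (\<integral>w. (norm (V w))\<^sup>2 \<partial>M)"
    using \<open>0 < \<omega>\<close> by simp
  moreover have "(\<integral>\<^sup>+ w. (norm (Q (\<xi> w) (V w) - V w))\<^sup>2 \<partial>M)
      = ennreal (\<integral>w. (norm (Q (\<xi> w) (V w) - V w))\<^sup>2 \<partial>M)"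
    using int by (rule nn_integral_eq_integral) simp
  ultimately show "(\<integral>w. (norm (Q (\<xi> w) (V w) - V w))\<^sup>2 \<partial>M) \<le> \<omega> * (\<integral>w. (norm (V w))\<^sup>2 \<partial>M)"
    using le by (simp add: ennreal_le_iff)
qed

text \<open>Argument and test vector are frozen together, hence the independence of the seed from
  the pair. What remains is a linear functional of the error, whose average over the seed is 0 by
  unbiasedness.\<close>

lemma quantization_error_orthogonal:
  assumes Q: "quantization_operator S Q \<omega>" and distr: "distr M S \<xi> = S"
    and ind: "indep_rv (borel \<Otimes>\<^sub>M borel) (\<lambda>w. (V w, Y w)) S \<xi>"
    and V: "sq_integrable M V" and Y: "sq_integrable M Y"
  shows "(\<integral>w. inner (Q (\<xi> w) (V w) - V w) (Y w) \<partial>M) = 0"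
proof -
  have ind': "indep_rv borel V S \<xi>"
    using indep_rv_compose1[OF ind, of fst borel] by simp
  have [measurable]:
    "(\<lambda>z. Q (snd z) (fst (fst z))) \<in> borel_measurable ((borel \<Otimes>\<^sub>M borel) \<Otimes>\<^sub>M S)"
    by (rule quantization_measurable[OF Q]) measurable
  have hm: "(\<lambda>z. inner (Q (snd z) (fst (fst z)) - fst (fst z)) (snd (fst z)))
      \<in> borel_measurable ((borel \<Otimes>\<^sub>M borel) \<Otimes>\<^sub>M S)"
    by measurable
  have "integrable M (\<lambda>w. inner (Q (\<xi> w) (V w) - V w) (Y w))"
    by (intro sq_integrable_inner quantization_error_sq[OF Q distr ind' V] Y)
  then have "(\<integral>w. inner (Q (\<xi> w) (V w) - V w) (Y w) \<partial>M)
      = (\<integral>w. (\<integral>s. inner (Q s (V w) - V w) (Y w) \<partial>S) \<partial>M)"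
    using indep_rv_integral_iterated(1)[OF ind hm] by (simp add: distr)
  moreover have "(\<integral>s. inner (Q s x - x) y \<partial>S) = 0" for x y
  proof -
    interpret S: prob_space S using Q by (simp add: quantization_operator_def)
    have "integrable S (\<lambda>s. Q s x)" "(\<integral>s. Q s x \<partial>S) = x"
      using Q by (auto simp: quantization_operator_def)
    then have "(\<integral>s. (Q s x - x) \<partial>S) = 0" "integrable S (\<lambda>s. Q s x - x)"
      by (auto simp: S.prob_space)
    then show ?thesis
      by (subst integral_inner_left) auto
  qed
  ultimately show ?thesis by simp
qed

text \<open>Applied to the coins, with \<open>A\<close> one of the two truth values, and to the
  returned index, with \<open>A\<close> a single iteration.\<close>

lemma indep_rv_integral_indicator:
  fixes Y :: "'a \<Rightarrow> real"
  assumes ind: "indep_rv borel Y (count_space UNIV) Z" and Y: "integrable M Y"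
  shows "(\<integral>w. indicator A (Z w) * Y w \<partial>M) = measure (distr M (count_space UNIV) Z) A * (\<integral>w. Y w \<partial>M)"
    and "integrable M (\<lambda>w. indicator A (Z w) * Y w)"
proof -
  have [measurable]: "Z \<in> measurable M (count_space UNIV)"
    using ind by (rule indep_rv_rv2)
  have [measurable]: "Y \<in> borel_measurable M" using ind by (rule indep_rv_rv1)
  have "(\<lambda>x. indicator A (snd x) :: real) \<in> borel_measurable (borel \<Otimes>\<^sub>M count_space UNIV)"
    by (rule measurable_compose[OF measurable_snd]) simp
  then have hm: "(\<lambda>x. indicator A (snd x) * fst x :: real) \<in> borel_measurable (borel \<Otimes>\<^sub>M count_space UNIV)"
    by (rule borel_measurable_times) (rule measurable_fst)
  have ZA: "(\<lambda>w. indicator A (Z w) :: real) \<in> borel_measurable M"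
    by (rule measurable_compose[of Z M "count_space UNIV"]) simp_all
  have "(\<lambda>w. indicator A (Z w) * Y w) \<in> borel_measurable M"
    by (rule borel_measurable_times[OF ZA]) measurable
  then show int: "integrable M (\<lambda>w. indicator A (Z w) * Y w)"
    by (rule Bochner_Integration.integrable_bound[OF Y]) (auto simp: indicator_def)
  show "(\<integral>w. indicator A (Z w) * Y w \<partial>M)
      = measure (distr M (count_space UNIV) Z) A * (\<integral>w. Y w \<partial>M)"
    using indep_rv_integral_iterated(1)[OF ind hm] int by simp
qed

end

section \<open>Minibatch differences, quadratic mean, further measurability\<close>

lemma borel_measurable_batch_diff:
  fixes f :: "nat \<Rightarrow> nat \<Rightarrow> 'a::euclidean_space \<Rightarrow> real"
  assumes diff: "\<And>j x. j < m \<Longrightarrow> f i j differentiable (at x)"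
    and J: "J \<in> measurable N (count_space UNIV)" and sub: "\<And>w. w \<in> space N \<Longrightarrow> J w \<subseteq> {..<m}"
    and u: "u \<in> borel_measurable N" and v: "v \<in> borel_measurable N"
  shows "(\<lambda>w. batch_diff b f i (J w) (u w) (v w)) \<in> borel_measurable N"
proof -
  \<comment> \<open>\<open>nat set\<close> is uncountable, so a countable split over the values of
    \<open>J\<close> is not possible. Membership of each single index is measurable, and it turns
    the sum over a random set into a sum over a fixed one.\<close>
  have "(\<lambda>w. (1 / real b) *\<^sub>R (\<Sum>j<m. of_bool (j \<in> J w) *\<^sub>R (grad (f i j) (v w) - grad (f i j) (u w))))
      \<in> borel_measurable N"
  proof (intro borel_measurable_scaleR borel_measurable_sum borel_measurable_diff borel_measurable_const)
    fix j assume "j \<in> {..<m}"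
    then have g: "grad (f i j) \<in> borel_measurable borel"
      by (intro borel_measurable_grad diff) auto
    show "(\<lambda>w. grad (f i j) (v w)) \<in> borel_measurable N" "(\<lambda>w. grad (f i j) (u w)) \<in> borel_measurable N"
      by (rule measurable_compose[OF v g], rule measurable_compose[OF u g])
    show "(\<lambda>w. of_bool (j \<in> J w) :: real) \<in> borel_measurable N"
      by (rule measurable_compose[OF J]) simp
  qed
  moreover have "batch_diff b f i (J w) (u w) (v w) =
      (1 / real b) *\<^sub>R (\<Sum>j<m. of_bool (j \<in> J w) *\<^sub>R (grad (f i j) (v w) - grad (f i j) (u w)))"
    if "w \<in> space N" for w
  proof -
    have "(\<Sum>j\<in>J w. grad (f i j) (v w) - grad (f i j) (u w))
        = (\<Sum>j<m. if j \<in> J w then grad (f i j) (v w) - grad (f i j) (u w) else 0)"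
      using sub[OF that] by (simp add: sum.If_cases Int_absorb1)
    also have "\<dots> = (\<Sum>j<m. of_bool (j \<in> J w) *\<^sub>R (grad (f i j) (v w) - grad (f i j) (u w)))"
      by (intro sum.cong) auto
    finally show ?thesis by (simp add: batch_diff_def)
  qed
  ultimately show ?thesis by (simp cong: measurable_cong)
qed

lemma sum_div_le_rms:
  assumes "1 \<le> n"
  shows "(1 / real n) * (\<Sum>i<n. L i) \<le> rms n L"
proof -
  have "(\<Sum>i<n. L i * 1)\<^sup>2 \<le> (\<Sum>i<n. (L i)\<^sup>2) * (\<Sum>i<n. 1\<^sup>2)"
    by (rule Cauchy_Schwarz_ineq_sum)
  then have "((1 / real n) * (\<Sum>i<n. L i))\<^sup>2 \<le> (1 / real n) * (\<Sum>i<n. (L i)\<^sup>2)"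
    using assms by (simp add: power_divide field_simps power2_eq_square)
  then show ?thesis
    unfolding rms_def by (rule real_le_rsqrt)
qed

lemma rms_sq:
  "(rms n L)\<^sup>2 = (1 / real n) * (\<Sum>i<n. (L i)\<^sup>2)" "0 \<le> rms n L"
  by (auto simp: rms_def sum_nonneg)

lemma sq_integrable_if:
  assumes U: "sq_integrable M U" and V: "sq_integrable M V" and P: "Measurable.pred M P"
  shows "sq_integrable M (\<lambda>w. if P w then U w else V w)"
proof (rule sq_integrableI)
  note [measurable] = sq_integrableD(1)[OF U] sq_integrableD(1)[OF V] P
  show "(\<lambda>w. if P w then U w else V w) \<in> borel_measurable M" by measurable
  show "integrable M (\<lambda>w. (norm (if P w then U w else V w))\<^sup>2)"
  proof (rule Bochner_Integration.integrable_bound)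
    show "integrable M (\<lambda>w. (norm (U w))\<^sup>2 + (norm (V w))\<^sup>2)"
      using sq_integrableD(2)[OF U] sq_integrableD(2)[OF V] by simp
    show "(\<lambda>w. (norm (if P w then U w else V w))\<^sup>2) \<in> borel_measurable M" by measurable
    show "AE w in M. norm ((norm (if P w then U w else V w))\<^sup>2) \<le> norm ((norm (U w))\<^sup>2 + (norm (V w))\<^sup>2)"
      by (rule AE_I2) simp
  qed
qed

lemma borel_measurable_component: "(\<lambda>v :: real ^ 'd. v $ l) \<in> borel_measurable borel"
  by (intro borel_measurable_continuous_onI continuous_on_component continuous_on_id)

lemma sq_integrable_nth:
  fixes V :: "'w \<Rightarrow> real ^ 'd"
  assumes V: "sq_integrable M V"
  shows "sq_integrable M (\<lambda>w. V w $ l)"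
proof (rule sq_integrable_bound[OF V, of _ 1])
  show "(\<lambda>w. V w $ l) \<in> borel_measurable M"
    by (rule measurable_compose[OF sq_integrableD(1)[OF V] borel_measurable_component])
qed (simp add: component_le_norm_cart)

lemma sets_vimage_algebra_subset: "sets (vimage_algebra X g N) \<subseteq> Pow X"
  using sets.space_closed[of "vimage_algebra X g N"] by simp

section \<open>A run of the method and its random inputs\<close>

locale vr_marina_run =
  fixes f :: "nat \<Rightarrow> nat \<Rightarrow> real ^ 'd \<Rightarrow> real"
    and n m b :: nat
    and M :: "'w measure"
    and S :: "'s measure" and Q :: "'s \<Rightarrow> real ^ 'd \<Rightarrow> real ^ 'd"
    and c :: "nat \<Rightarrow> 'w \<Rightarrow> bool" and I :: "nat \<Rightarrow> nat \<Rightarrow> 'w \<Rightarrow> nat set"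
    and \<xi> :: "nat \<Rightarrow> nat \<Rightarrow> 'w \<Rightarrow> 's" and pick :: "nat \<Rightarrow> 'w \<Rightarrow> nat"
    and x0 :: "real ^ 'd" and \<gamma> p \<omega> fstar :: real
    and L \<L> :: "nat \<Rightarrow> real"
    and X :: "nat \<Rightarrow> 'w \<Rightarrow> real ^ 'd"
    and D Dt :: "nat \<Rightarrow> nat \<Rightarrow> 'w \<Rightarrow> real ^ 'd"
  assumes sizes: "1 \<le> n" "1 \<le> m" "1 \<le> b"
    and differentiable: "\<And>i j x. i < n \<Longrightarrow> j < m \<Longrightarrow> f i j differentiable (at x)"
    and lower_bound: "\<And>x. fstar \<le> global_loss n m f x"
    and smooth: "\<And>i. i < n \<Longrightarrow> smooth_with (L i) (local_loss m f i)"
    and quantization: "quantization_operator S Q \<omega>"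
    and prob: "0 < p" "p \<le> 1"
    and inputs: "vr_marina_inputs M S n m b p c I \<xi> pick"
    and X: "X = (\<lambda>k w. fst (vr_marina n m b f Q \<gamma> x0
                   (\<lambda>k. c k w) (\<lambda>i k. I i k w) (\<lambda>i k. \<xi> i k w) k))"
    and D: "D = (\<lambda>i k w. grad (local_loss m f i) (X (Suc k) w) - grad (local_loss m f i) (X k w))"
    and Dt: "Dt = (\<lambda>i k w. batch_diff b f i (I i k w) (X k w) (X (Suc k) w))"
    and avg_smooth: "average_smoothness M n b \<L> X D Dt"
    and \<gamma>_pos: "0 < \<gamma>"
begin

sublocale prob_space M
  using inputs by (simp add: vr_marina_inputs_def)

lemma coin_measurable: "c k \<in> measurable M (count_space UNIV)"
  and coin_distr: "distr M (count_space UNIV) (c k) = measure_pmf (bernoulli_pmf p)"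
  and batch_subset: "i < n \<Longrightarrow> w \<in> space M \<Longrightarrow> I i k w \<subseteq> {..<m}"
  and batch_card: "i < n \<Longrightarrow> w \<in> space M \<Longrightarrow> card (I i k w) = b"
  and seed_measurable: "i < n \<Longrightarrow> \<xi> i k \<in> measurable M S"
  and seed_distr: "i < n \<Longrightarrow> distr M S (\<xi> i k) = S"
  and pick_measurable: "1 \<le> K \<Longrightarrow> pick K \<in> measurable M (count_space UNIV)"
  and pick_distr: "1 \<le> K \<Longrightarrow> distr M (count_space UNIV) (pick K) = measure_pmf (pmf_of_set {..<K})"
  using inputs by (auto simp: vr_marina_inputs_def)

subsection \<open>Information generated by sets of sources\<close>

definition sources :: "source set" where
  "sources = range Coin \<union> {Batch i k | i k. i < n} \<union> {Seed i k | i k. i < n} \<union> {Pick K | K. 1 \<le> K}"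

definition info :: "source set \<Rightarrow> 'w measure" where
  "info R = sigma (space M) (\<Union>r\<in>R. source_events M S c I \<xi> pick r)"

lemma sources_indep: "indep_sets (source_events M S c I \<xi> pick) sources"
  using inputs by (simp add: vr_marina_inputs_def sources_def)

lemma source_events_subset: "source_events M S c I \<xi> pick r \<subseteq> Pow (space M)"
  by (cases r) (simp_all add: source_events_def sets_vimage_algebra_subset)

lemma space_info [simp]: "space (info R) = space M"
  unfolding info_def using source_events_subset by (intro space_measure_of) blast

lemma sets_info: "sets (info R) = sigma_sets (space M) (\<Union>r\<in>R. source_events M S c I \<xi> pick r)"
  unfolding info_def using source_events_subset by (intro sets_measure_of) blast

lemma measurable_infoI:
  assumes "r \<in> R" "source_events M S c I \<xi> pick r = sets (vimage_algebra (space M) g N)"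
    and "g \<in> space M \<rightarrow> space N"
  shows "g \<in> measurable (info R) N"
proof (rule measurableI)
  fix A assume "A \<in> sets N"
  then have "g -` A \<inter> space M \<in> source_events M S c I \<xi> pick r"
    unfolding assms(2) by (rule in_vimage_algebra)
  then show "g -` A \<inter> space (info R) \<in> sets (info R)"
    unfolding sets_info using assms(1) by (auto intro!: sigma_sets.Basic)
qed (use assms(3) in auto)

lemma coin_measurable_info: "Coin k \<in> R \<Longrightarrow> c k \<in> measurable (info R) (count_space UNIV)"
  and batch_measurable_info: "Batch i k \<in> R \<Longrightarrow> I i k \<in> measurable (info R) (count_space UNIV)"
  and pick_measurable_info: "Pick K \<in> R \<Longrightarrow> pick K \<in> measurable (info R) (count_space UNIV)"
  by (rule measurable_infoI, assumption, auto simp: source_events_def)+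

lemma seed_measurable_info: "Seed i k \<in> R \<Longrightarrow> i < n \<Longrightarrow> \<xi> i k \<in> measurable (info R) S"
  using measurable_space[OF seed_measurable[of i k]]
  by (intro measurable_infoI[of "Seed i k"]) (auto simp: source_events_def)

text \<open>The restriction to \<open>sources\<close> matters: for workers i \<ge> n the minibatch
  and seed maps are unconstrained, and \<open>info R\<close> could contain sets that are not
  events.\<close>

lemma measurable_info_imp:
  assumes "R \<subseteq> sources" "V \<in> measurable (info R) N"
  shows "V \<in> measurable M N"
proof -
  have "(\<Union>r\<in>R. source_events M S c I \<xi> pick r) \<subseteq> events"
    using sources_indep assms(1) by (auto simp: indep_sets_def)
  then have "sets (info R) \<subseteq> sets M"
    unfolding sets_info by (rule sets.sigma_sets_subset)
  then have "measurable (info R) N \<subseteq> measurable M N"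
    by (intro measurable_mono) auto
  with assms(2) show ?thesis by blast
qed

text \<open>Independent families of events stay independent when grouped along disjoint index sets.
  Every later independence claim becomes a comparison of the sources that two variables
  read.\<close>

lemma indep_rv_info:
  assumes R: "R1 \<subseteq> sources" "R2 \<subseteq> sources" "R1 \<inter> R2 = {}"
    and V: "V \<in> measurable (info R1) N" and W: "W \<in> measurable (info R2) N'"
  shows "indep_rv N V N' W"
proof -
  have "indep_sets (\<lambda>j. sigma_sets (space M) (\<Union>r\<in>case_bool R1 R2 j. source_events M S c I \<xi> pick r)) UNIV"
  proof (rule indep_sets_collect_sigma)
    show "indep_sets (source_events M S c I \<xi> pick) (\<Union>j\<in>UNIV. case_bool R1 R2 j)"
      by (rule indep_sets_mono_index[OF _ sources_indep]) (use R in \<open>auto split: bool.splits\<close>)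
    show "disjoint_family_on (case_bool R1 R2) UNIV"
      using R(3) by (auto simp: disjoint_family_on_def split: bool.splits)
    fix r
    have "Int_stable (sets (N'' :: 'w measure))" for N''
      by (auto simp: Int_stable_def)
    then show "Int_stable (source_events M S c I \<xi> pick r)"
      by (cases r) (simp_all add: source_events_def)
  qed
  also have "(\<lambda>j. sigma_sets (space M) (\<Union>r\<in>case_bool R1 R2 j. source_events M S c I \<xi> pick r))
      = case_bool (sets (info R1)) (sets (info R2))"
    by (rule ext) (simp add: sets_info split: bool.split)
  finally have ind: "indep_set (sets (info R1)) (sets (info R2))"
    by (simp add: indep_set_def)
  show ?thesis
    unfolding indep_rv_def
    using measurable_info_imp[OF R(1) V] measurable_info_imp[OF R(2) W]
      measurable_sets[OF V] measurable_sets[OF W] indep_setD[OF ind] by simp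
qed

subsection \<open>The iterates\<close>

definition G :: "nat \<Rightarrow> 'w \<Rightarrow> real ^ 'd" where
  "G k w = snd (vr_marina n m b f Q \<gamma> x0 (\<lambda>k. c k w) (\<lambda>i k. I i k w) (\<lambda>i k. \<xi> i k w) k)"

lemma local_loss_differentiable: "i < n \<Longrightarrow> local_loss m f i differentiable (at x)"
  using differentiable unfolding local_loss_def[abs_def]
  by (intro differentiable_mult differentiable_const differentiable_sum) auto

lemma global_loss_differentiable: "global_loss n m f differentiable (at x)"
  using local_loss_differentiable unfolding global_loss_def[abs_def]
  by (intro differentiable_mult differentiable_const differentiable_sum) auto

lemma grad_global_loss:
  "grad (global_loss n m f) x = (1 / real n) *\<^sub>R (\<Sum>i<n. grad (local_loss m f i) x)"
  unfolding global_loss_def[abs_def] by (rule grad_scaled_sum) (rule local_loss_differentiable)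

text \<open>The triangle inequality gives the arithmetic mean of the L_i, and by Cauchy-Schwarz this
  is at most their quadratic mean.\<close>

lemma smooth_global_loss: "smooth_with (rms n L) (global_loss n m f)"
  unfolding smooth_with_def
proof (intro allI)
  fix x y
  have "norm (grad (global_loss n m f) x - grad (global_loss n m f) y)
      = (1 / real n) * norm (\<Sum>i<n. grad (local_loss m f i) x - grad (local_loss m f i) y)"
    by (simp add: grad_global_loss sum_subtractf flip: scaleR_diff_right)
  also have "\<dots> \<le> (1 / real n) * (\<Sum>i<n. L i * norm (x - y))"
    using smooth unfolding smooth_with_def by (intro mult_left_mono sum_norm_le) auto
  also have "\<dots> = ((1 / real n) * (\<Sum>i<n. L i)) * norm (x - y)"
    by (simp add: sum_distrib_right)
  also have "\<dots> \<le> rms n L * norm (x - y)"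
    by (intro mult_right_mono sum_div_le_rms sizes) auto
  finally show "norm (grad (global_loss n m f) x - grad (global_loss n m f) y) \<le> rms n L * norm (x - y)" .
qed

lemma borel_measurable_grad_local [measurable]:
  "i < n \<Longrightarrow> grad (local_loss m f i) \<in> borel_measurable borel"
  by (intro borel_measurable_grad local_loss_differentiable)

lemma borel_measurable_grad_global [measurable]:
  "grad (global_loss n m f) \<in> borel_measurable borel"
  by (intro borel_measurable_grad global_loss_differentiable)

lemma X_0: "X 0 w = x0"
  and G_0: "G 0 w = grad (global_loss n m f) x0"
  and X_Suc: "X (Suc k) w = X k w - \<gamma> *\<^sub>R G k w"
  by (simp_all add: X G_def Let_def split_beta)

lemma G_Suc: "G (Suc k) w = (if c k w then grad (global_loss n m f) (X (Suc k) w)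
    else G k w + (1 / real n) *\<^sub>R (\<Sum>i<n. Q (\<xi> i k w) (Dt i k w)))"
proof -
  have "(1 / real n) *\<^sub>R (\<Sum>i<n. G k w + q i) = G k w + (1 / real n) *\<^sub>R (\<Sum>i<n. q i)" for q
    using sizes(1) by (simp add: sum.distrib scaleR_add_right sum_constant_scaleR del: sum_constant)
  then show ?thesis
    by (simp add: G_def X Dt Let_def split_beta grad_global_loss)
qed

definition past :: "nat \<Rightarrow> source set" where
  "past k = {Coin j | j. j < k} \<union> {Batch i j | i j. i < n \<and> j < k} \<union> {Seed i j | i j. i < n \<and> j < k}"

lemma past_sources: "past k \<subseteq> sources"
  by (auto simp: past_def sources_def)

lemma batch_diff_measurable_info:
  assumes "i < n" "Batch i k \<in> R" "u \<in> borel_measurable (info R)" "v \<in> borel_measurable (info R)"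
  shows "(\<lambda>w. batch_diff b f i (I i k w) (u w) (v w)) \<in> borel_measurable (info R)"
  using assms differentiable batch_subset
  by (intro borel_measurable_batch_diff[where m = m] batch_measurable_info) auto

lemma iterate_measurable_info:
  assumes "past k \<subseteq> R"
  shows "X k \<in> borel_measurable (info R)" "G k \<in> borel_measurable (info R)"
proof -
  have "X k \<in> borel_measurable (info R) \<and> G k \<in> borel_measurable (info R)"
    using assms
  proof (induction k)
    case 0
    have "X 0 = (\<lambda>w. x0)" "G 0 = (\<lambda>w. grad (global_loss n m f) x0)"
      by (auto simp: X_0 G_0)
    then show ?case by simp
  next
    case (Suc k)
    have "past k \<subseteq> past (Suc k)" by (auto simp: past_def)
    with Suc have [measurable]: "X k \<in> borel_measurable (info R)" "G k \<in> borel_measurable (info R)"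
      by auto
    have X': "X (Suc k) = (\<lambda>w. X k w - \<gamma> *\<^sub>R G k w)" by (auto simp: X_Suc)
    have [measurable]: "X (Suc k) \<in> borel_measurable (info R)"
      unfolding X' by measurable
    have "Coin k \<in> R" using Suc.prems by (auto simp: past_def)
    then have [measurable]: "Measurable.pred (info R) (c k)" by (rule coin_measurable_info)
    have "(\<lambda>w. Q (\<xi> i k w) (Dt i k w)) \<in> borel_measurable (info R)" if "i < n" for i
    proof (rule quantization_measurable[OF quantization])
      have "Seed i k \<in> R" "Batch i k \<in> R" using Suc.prems that by (auto simp: past_def)
      then show "\<xi> i k \<in> measurable (info R) S"
        and "Dt i k \<in> borel_measurable (info R)"
        unfolding Dt using that by (auto intro!: seed_measurable_info batch_diff_measurable_info)
    qed
    then have [measurable]: "(\<lambda>w. \<Sum>i<n. Q (\<xi> i k w) (Dt i k w)) \<in> borel_measurable (info R)"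
      by (intro borel_measurable_sum) auto
    have "G (Suc k) = (\<lambda>w. if c k w then grad (global_loss n m f) (X (Suc k) w)
        else G k w + (1 / real n) *\<^sub>R (\<Sum>i<n. Q (\<xi> i k w) (Dt i k w)))"
      by (auto simp: G_Suc)
    also have "\<dots> \<in> borel_measurable (info R)" by measurable
    finally show ?case by simp
  qed
  then show "X k \<in> borel_measurable (info R)" "G k \<in> borel_measurable (info R)" by auto
qed

text \<open>An off-by-one that carries much of the proof: x^(k+1) is computed from x^k and g^k,
  before any coin, minibatch or seed of round k is read.\<close>

lemma X_Suc_measurable_info: "past k \<subseteq> R \<Longrightarrow> X (Suc k) \<in> borel_measurable (info R)"
  using iterate_measurable_info[of k R] by (simp add: X_Suc[abs_def] cong: measurable_cong)

lemma iterate_measurable [measurable]: "X k \<in> borel_measurable M" "G k \<in> borel_measurable M"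
  using iterate_measurable_info[of k "past k"] measurable_info_imp[OF past_sources] by auto

lemma D_measurable_info:
  assumes "i < n" "past k \<subseteq> R"
  shows "D i k \<in> borel_measurable (info R)"
  unfolding D using assms iterate_measurable_info[of k R] X_Suc_measurable_info[of k R]
  by measurable

lemma Dt_measurable_info:
  assumes "i < n" "insert (Batch i k) (past k) \<subseteq> R"
  shows "Dt i k \<in> borel_measurable (info R)"
  unfolding Dt using assms
  by (intro batch_diff_measurable_info iterate_measurable_info X_Suc_measurable_info) auto

lemma quantized_measurable_info:
  assumes "i < n" "insert (Seed i k) (insert (Batch i k) (past k)) \<subseteq> R"
  shows "(\<lambda>w. Q (\<xi> i k w) (Dt i k w)) \<in> borel_measurable (info R)"
  using assms by (intro quantization_measurable[OF quantization] seed_measurable_info Dt_measurable_info) auto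

end

text \<open>The pair of iterates used for conditioning carries the Borel algebra of the product
  type, so the projections are wanted for \<open>borel\<close> instead of a pair measure.\<close>

lemma borel_measurable_fst_snd:
  "fst \<in> borel_measurable (borel :: ('a::second_countable_topology \<times> 'b::second_countable_topology) measure)"
  "snd \<in> borel_measurable (borel :: ('a::second_countable_topology \<times> 'b::second_countable_topology) measure)"
  by (intro borel_measurable_continuous_onI continuous_intros)+

section \<open>Gradient, minibatch and quantization errors\<close>

context vr_marina_run
begin

definition step :: "nat \<Rightarrow> 'w \<Rightarrow> real ^ 'd" where
  "step k w = X (Suc k) w - X k w"

definition err :: "nat \<Rightarrow> 'w \<Rightarrow> real ^ 'd" where
  "err k w = G k w - grad (global_loss n m f) (X k w)"

definition batch_err :: "nat \<Rightarrow> nat \<Rightarrow> 'w \<Rightarrow> real ^ 'd" where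
  "batch_err i k w = Dt i k w - D i k w"

definition quant_err :: "nat \<Rightarrow> nat \<Rightarrow> 'w \<Rightarrow> real ^ 'd" where
  "quant_err i k w = Q (\<xi> i k w) (Dt i k w) - Dt i k w"

lemma \<omega>_pos: "0 < \<omega>"
  using quantization by (simp add: quantization_operator_def)

lemma err_measurable_info: "past k \<subseteq> R \<Longrightarrow> err k \<in> borel_measurable (info R)"
  unfolding err_def[abs_def] using iterate_measurable_info[of k R] by measurable

lemma batch_err_measurable_info:
  "i < n \<Longrightarrow> insert (Batch i k) (past k) \<subseteq> R \<Longrightarrow> batch_err i k \<in> borel_measurable (info R)"
  unfolding batch_err_def[abs_def]
  by (intro borel_measurable_diff Dt_measurable_info D_measurable_info) auto

lemma quant_err_measurable_info:
  "i < n \<Longrightarrow> insert (Seed i k) (insert (Batch i k) (past k)) \<subseteq> R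
    \<Longrightarrow> quant_err i k \<in> borel_measurable (info R)"
  unfolding quant_err_def[abs_def]
  by (intro borel_measurable_diff Dt_measurable_info quantized_measurable_info) auto

lemma insert_Batch_past_sources: "i < n \<Longrightarrow> insert (Batch i k) (past k) \<subseteq> sources"
  using past_sources[of k] by (auto simp: sources_def)

lemma insert_Seed_past_sources:
  "i < n \<Longrightarrow> insert (Seed i k) (insert (Batch i k) (past k)) \<subseteq> sources"
  using past_sources[of k] by (auto simp: sources_def)

lemma batch_err_measurable: "i < n \<Longrightarrow> batch_err i k \<in> borel_measurable M"
  by (rule measurable_info_imp[OF insert_Batch_past_sources batch_err_measurable_info[OF _ subset_refl]])

lemma D_measurable: "i < n \<Longrightarrow> D i k \<in> borel_measurable M"
  by (rule measurable_info_imp[OF past_sources D_measurable_info[OF _ subset_refl]])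

subsection \<open>Second moments\<close>

lemma sq_integrable_step: "sq_integrable M (G k) \<Longrightarrow> sq_integrable M (step k)"
  using sq_integrable_scaleR[of M "G k" "- \<gamma>"] by (simp add: step_def[abs_def] X_Suc)

lemma D_norm_le: "i < n \<Longrightarrow> norm (D i k w) \<le> L i * norm (step k w)"
  using smooth by (simp add: D smooth_with_def step_def)

lemma sq_integrable_D:
  assumes "i < n" "sq_integrable M (G k)"
  shows "sq_integrable M (D i k)"
  using sq_integrable_bound[OF sq_integrable_step[OF assms(2)] D_measurable[OF assms(1)] D_norm_le[OF assms(1)]] .

lemma integral_D_sq_le:
  assumes "i < n" "sq_integrable M (G k)"
  shows "(\<integral>w. (norm (D i k w))\<^sup>2 \<partial>M) \<le> (L i)\<^sup>2 * (\<integral>w. (norm (step k w))\<^sup>2 \<partial>M)"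
proof -
  have "(norm (D i k w))\<^sup>2 \<le> (L i)\<^sup>2 * (norm (step k w))\<^sup>2" for w
    using power_mono[OF D_norm_le[OF assms(1)], of k w 2] by (simp add: power_mult_distrib)
  then have "(\<integral>w. (norm (D i k w))\<^sup>2 \<partial>M) \<le> (\<integral>w. (L i)\<^sup>2 * (norm (step k w))\<^sup>2 \<partial>M)"
    using sq_integrableD(2)[OF sq_integrable_D[OF assms]] sq_integrableD(2)[OF sq_integrable_step[OF assms(2)]]
    by (intro integral_mono) auto
  then show ?thesis by simp
qed

definition pair_info :: "nat \<Rightarrow> 'w measure" where
  "pair_info k = vimage_algebra (space M) (\<lambda>w. (X k w, X (Suc k) w)) borel"

lemma sigma_finite_subalgebra_pair_info: "sigma_finite_subalgebra M (pair_info k)"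
proof -
  have "(\<lambda>w. (X k w, X (Suc k) w)) \<in> borel_measurable M" by measurable
  then have "subalgebra M (pair_info k)"
    unfolding subalgebra_def pair_info_def by (simp add: sets_image_in_sets)
  then show ?thesis
    by (intro finite_measure_subalgebra_is_sigma_finite)
       (simp add: finite_measure_subalgebra_def finite_measure_subalgebra_axioms_def finite_measure_axioms)
qed

lemma average_smoothnessD:
  assumes "i < n"
  shows "AE w in M. real_cond_exp M (pair_info k) (\<lambda>w. Dt i k w $ l) w = D i k w $ l"
    and "AE w in M. nn_cond_exp M (pair_info k) (\<lambda>w. ennreal ((norm (batch_err i k w))\<^sup>2)) w
            \<le> ennreal ((\<L> i)\<^sup>2 / real b * (norm (step k w))\<^sup>2)"
  using avg_smooth assms
  by (auto simp: average_smoothness_def Let_def pair_info_def batch_err_def step_def)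

text \<open>The conditional bound is averaged with the nonnegative conditional expectation, so the
  finiteness of the second moment is obtained along with its bound.\<close>

lemma batch_err_sq:
  assumes i: "i < n" and G: "sq_integrable M (G k)"
  shows "sq_integrable M (batch_err i k)"
    and "(\<integral>w. (norm (batch_err i k w))\<^sup>2 \<partial>M) \<le> (\<L> i)\<^sup>2 / real b * (\<integral>w. (norm (step k w))\<^sup>2 \<partial>M)"
proof -
  interpret F: sigma_finite_subalgebra M "pair_info k" by (rule sigma_finite_subalgebra_pair_info)
  note [measurable] = batch_err_measurable[OF i]
  have "(\<integral>\<^sup>+ w. ennreal ((norm (batch_err i k w))\<^sup>2) \<partial>M)
      = (\<integral>\<^sup>+ w. nn_cond_exp M (pair_info k) (\<lambda>w. ennreal ((norm (batch_err i k w))\<^sup>2)) w \<partial>M)"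
    using F.nn_cond_exp_intg[of "\<lambda>_. 1" "\<lambda>w. ennreal ((norm (batch_err i k w))\<^sup>2)"] by simp
  also have "\<dots> \<le> (\<integral>\<^sup>+ w. ennreal ((\<L> i)\<^sup>2 / real b * (norm (step k w))\<^sup>2) \<partial>M)"
    by (rule nn_integral_mono_AE) (rule average_smoothnessD(2)[OF i])
  also have "\<dots> = ennreal (\<integral>w. (\<L> i)\<^sup>2 / real b * (norm (step k w))\<^sup>2 \<partial>M)"
    using sq_integrableD(2)[OF sq_integrable_step[OF G]] by (intro nn_integral_eq_integral) auto
  also have "\<dots> = ennreal ((\<L> i)\<^sup>2 / real b * (\<integral>w. (norm (step k w))\<^sup>2 \<partial>M))" by simp
  finally have le: "(\<integral>\<^sup>+ w. ennreal ((norm (batch_err i k w))\<^sup>2) \<partial>M)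
      \<le> ennreal ((\<L> i)\<^sup>2 / real b * (\<integral>w. (norm (step k w))\<^sup>2 \<partial>M))" .
  have int: "integrable M (\<lambda>w. (norm (batch_err i k w))\<^sup>2)"
  proof (rule integrableI_bounded)
    show "(\<integral>\<^sup>+ w. norm ((norm (batch_err i k w))\<^sup>2) \<partial>M) < \<infinity>"
      using le_less_trans[OF le ennreal_less_top] by simp
  qed measurable
  then show "sq_integrable M (batch_err i k)"
    by (intro sq_integrableI) measurable
  have "0 \<le> (\<L> i)\<^sup>2 / real b * (\<integral>w. (norm (step k w))\<^sup>2 \<partial>M)"
    by simp
  moreover have "(\<integral>\<^sup>+ w. ennreal ((norm (batch_err i k w))\<^sup>2) \<partial>M) = ennreal (\<integral>w. (norm (batch_err i k w))\<^sup>2 \<partial>M)"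
    using int by (rule nn_integral_eq_integral) simp
  ultimately show "(\<integral>w. (norm (batch_err i k w))\<^sup>2 \<partial>M) \<le> (\<L> i)\<^sup>2 / real b * (\<integral>w. (norm (step k w))\<^sup>2 \<partial>M)"
    using le by (simp add: ennreal_le_iff)
qed

lemma sq_integrable_Dt:
  assumes "i < n" "sq_integrable M (G k)"
  shows "sq_integrable M (Dt i k)"
  using sq_integrable_add[OF batch_err_sq(1)[OF assms] sq_integrable_D[OF assms]]
  by (simp add: batch_err_def)

lemma Dt_seed_indep:
  assumes i: "i < n"
  shows "indep_rv borel (Dt i k) S (\<xi> i k)"
proof (rule indep_rv_info[of "insert (Batch i k) (past k)" "{Seed i k}"])
  show "insert (Batch i k) (past k) \<inter> {Seed i k} = {}" by (auto simp: past_def)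
  show "insert (Batch i k) (past k) \<subseteq> sources" "{Seed i k} \<subseteq> sources"
    using insert_Seed_past_sources[OF i] by auto
qed (use i in \<open>auto intro: Dt_measurable_info seed_measurable_info\<close>)

lemma quant_err_sq:
  assumes i: "i < n" and G: "sq_integrable M (G k)"
  shows "sq_integrable M (quant_err i k)"
    and "(\<integral>w. (norm (quant_err i k w))\<^sup>2 \<partial>M) \<le> \<omega> * (\<integral>w. (norm (Dt i k w))\<^sup>2 \<partial>M)"
  using quantization_error_sq[OF quantization seed_distr[OF i] Dt_seed_indep[OF i] sq_integrable_Dt[OF i G]]
  by (simp_all add: quant_err_def[abs_def])

text \<open>A Lipschitz gradient grows at most linearly away from its value at the fixed point
  \<open>x0\<close>.\<close>

lemma sq_integrable_grad_global:
  assumes "sq_integrable M (X k)"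
  shows "sq_integrable M (\<lambda>w. grad (global_loss n m f) (X k w))"
proof -
  have const: "sq_integrable M (\<lambda>w. v)" for v :: "real ^ 'd"
    by (intro sq_integrableI) auto
  have "sq_integrable M (\<lambda>w. grad (global_loss n m f) (X k w) - grad (global_loss n m f) x0)"
    using smooth_global_loss
    by (intro sq_integrable_bound[OF sq_integrable_diff[OF assms const[of x0]]])
       (auto simp: smooth_with_def)
  from sq_integrable_add[OF this const[of "grad (global_loss n m f) x0"]] show ?thesis by simp
qed

lemma coin_pred [measurable]: "Measurable.pred M (c k)"
  by (rule coin_measurable)

text \<open>Closes the loop behind the hypothesis on \<open>G k\<close> in the preceding bounds:
  from g^k it passes to the step, the exact and minibatch differences, the quantized differences,
  and so to g^(k+1).\<close>

lemma sq_integrable_iterates: "sq_integrable M (X k)" "sq_integrable M (G k)"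
proof -
  have "sq_integrable M (X k) \<and> sq_integrable M (G k)"
  proof (induction k)
    case 0
    have "X 0 = (\<lambda>w. x0)" "G 0 = (\<lambda>w. grad (global_loss n m f) x0)"
      by (auto simp: X_0 G_0)
    then show ?case by (auto simp: sq_integrable_def)
  next
    case (Suc k)
    then have XG: "sq_integrable M (X k)" "sq_integrable M (G k)" by auto
    have X': "sq_integrable M (X (Suc k))"
      using sq_integrable_diff[OF XG(1) sq_integrable_scaleR[OF XG(2)]] by (simp add: X_Suc[abs_def])
    have "sq_integrable M (\<lambda>w. Q (\<xi> i k w) (Dt i k w))" if "i < n" for i
      using sq_integrable_add[OF quant_err_sq(1)[OF that XG(2)] sq_integrable_Dt[OF that XG(2)]]
      by (simp add: quant_err_def)
    then have "sq_integrable M (\<lambda>w. if c k w then grad (global_loss n m f) (X (Suc k) w)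
        else G k w + (1 / real n) *\<^sub>R (\<Sum>i<n. Q (\<xi> i k w) (Dt i k w)))"
      by (intro sq_integrable_if sq_integrable_add sq_integrable_scaleR sq_integrable_sum
          sq_integrable_grad_global X' XG coin_pred) auto
    with X' show ?case by (simp add: G_Suc[abs_def])
  qed
  then show "sq_integrable M (X k)" "sq_integrable M (G k)" by auto
qed

lemma sq_integrable_err: "sq_integrable M (err k)"
  unfolding err_def[abs_def]
  by (intro sq_integrable_diff sq_integrable_grad_global sq_integrable_iterates)

subsection \<open>Orthogonality of the errors\<close>

text \<open>The test function may read minibatches of the same round and seeds of other workers,
  only not this seed. \<open>R\<close> also covers what \<open>Dt i k\<close> reads, so that
  \<open>Dt i k\<close> and \<open>Y\<close> are jointly independent of the seed.\<close>

lemma quant_err_orthogonal: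
  assumes i: "i < n" and Y: "sq_integrable M Y" and R: "R \<subseteq> sources" "Seed i k \<notin> R"
    and YR: "Y \<in> borel_measurable (info R)"
    and BR: "insert (Batch i k) (past k) \<subseteq> R"
  shows "(\<integral>w. inner (quant_err i k w) (Y w) \<partial>M) = 0"
proof -
  have "indep_rv (borel \<Otimes>\<^sub>M borel) (\<lambda>w. (Dt i k w, Y w)) S (\<xi> i k)"
    by (rule indep_rv_info[of R "{Seed i k}"])
       (use i R YR BR Dt_measurable_info[OF i BR] seed_measurable_info[OF _ i] in \<open>auto simp: sources_def\<close>)
  then show ?thesis
    using quantization_error_orthogonal[OF quantization seed_distr[OF i] _ sq_integrable_Dt[OF i sq_integrable_iterates(2)] Y]
    by (simp add: quant_err_def)
qed

text \<open>A function of the two iterates is measurable for \<open>pair_info k\<close> and may be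
  moved inside the conditional expectation. The argument runs componentwise because the conditional
  mean is given componentwise.\<close>

lemma batch_err_orthogonal:
  assumes i: "i < n" and \<phi>: "\<phi> \<in> borel_measurable borel"
    and Y: "sq_integrable M (\<lambda>w. \<phi> (X k w, X (Suc k) w))"
  shows "(\<integral>w. inner (batch_err i k w) (\<phi> (X k w, X (Suc k) w)) \<partial>M) = 0"
proof -
  interpret F: sigma_finite_subalgebra M "pair_info k" by (rule sigma_finite_subalgebra_pair_info)
  let ?Y = "\<lambda>w. \<phi> (X k w, X (Suc k) w)"
  have "(\<integral>w. batch_err i k w $ l * ?Y w $ l \<partial>M) = 0"
    and "integrable M (\<lambda>w. batch_err i k w $ l * ?Y w $ l)" for l
  proof -
    have Yl: "sq_integrable M (\<lambda>w. ?Y w $ l)" and Dtl: "sq_integrable M (\<lambda>w. Dt i k w $ l)"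
      and Dl: "sq_integrable M (\<lambda>w. D i k w $ l)"
      by (intro sq_integrable_nth Y sq_integrable_Dt sq_integrable_D i sq_integrable_iterates)+
    have int: "integrable M (\<lambda>w. ?Y w $ l * Dt i k w $ l)" "integrable M (\<lambda>w. ?Y w $ l * D i k w $ l)"
      using sq_integrable_inner[OF Yl Dtl] sq_integrable_inner[OF Yl Dl] by simp_all
    from measurable_compose[OF \<phi> borel_measurable_component]
    have Ym: "(\<lambda>w. ?Y w $ l) \<in> borel_measurable (pair_info k)"
      unfolding pair_info_def
      by (rule measurable_compose[OF measurable_vimage_algebra1, rotated]) simp
    note [measurable] = sq_integrableD(1)[OF Yl] sq_integrableD(1)[OF Dl] sq_integrableD(1)[OF Dtl]
    have "(\<integral>w. ?Y w $ l * Dt i k w $ l \<partial>M)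
        = (\<integral>w. ?Y w $ l * real_cond_exp M (pair_info k) (\<lambda>w. Dt i k w $ l) w \<partial>M)"
      using F.real_cond_exp_intg(2)[OF int(1) Ym] by simp
    also have "\<dots> = (\<integral>w. ?Y w $ l * D i k w $ l \<partial>M)"
      using average_smoothnessD(1)[OF i, of k l] by (intro integral_cong_AE) auto
    finally have eq: "(\<integral>w. ?Y w $ l * Dt i k w $ l \<partial>M) = (\<integral>w. ?Y w $ l * D i k w $ l \<partial>M)" .
    have split: "batch_err i k w $ l * ?Y w $ l = ?Y w $ l * Dt i k w $ l - ?Y w $ l * D i k w $ l" for w
      by (simp add: batch_err_def algebra_simps)
    show "(\<integral>w. batch_err i k w $ l * ?Y w $ l \<partial>M) = 0"
      using int eq unfolding split by simp
    show "integrable M (\<lambda>w. batch_err i k w $ l * ?Y w $ l)"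
      using int unfolding split by simp
  qed
  then show ?thesis by (simp add: inner_vec_def)
qed

text \<open>Besides the two iterates, the error of worker j depends on its minibatch only, and this
  minibatch is independent of the iterates together with the error of worker i. With it fixed,
  \<open>batch_err_orthogonal\<close> applies.\<close>

lemma batch_err_pairwise_orthogonal:
  assumes i: "i < n" and j: "j < n" and "i \<noteq> j"
  shows "(\<integral>w. inner (batch_err i k w) (batch_err j k w) \<partial>M) = 0"
proof -
  \<comment> \<open>Intersecting with \<open>{..<m}\<close> leaves actual minibatches unchanged and
    makes \<open>\<psi> J\<close> measurable for every \<open>J\<close>: component functions with
    index m or above are not assumed differentiable.\<close>
  define \<psi> where "\<psi> J z = batch_diff b f j (J \<inter> {..<m}) (fst z) (snd z)
      - (grad (local_loss m f j) (snd z) - grad (local_loss m f j) (fst z))"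
    for J and z :: "(real ^ 'd) \<times> (real ^ 'd)"
  define Z where "Z w = (X k w, X (Suc k) w)" for w
  define W where "W w = (Z w, batch_err i k w)" for w
  have \<psi>_eq: "batch_err j k w = \<psi> (I j k w) (Z w)" if "w \<in> space M" for w
    using batch_subset[OF j that, of k] unfolding batch_err_def unfolding \<psi>_def Z_def D Dt
    by (simp add: Int_absorb2)
  have \<psi>_meas: "(\<lambda>w. \<psi> (J w) (z w)) \<in> borel_measurable N"
    if J: "J \<in> measurable N (count_space UNIV)" and z[measurable]: "z \<in> borel_measurable N"
    for N :: "'x measure" and J z
  proof -
    have [measurable]: "(\<lambda>w. fst (z w)) \<in> borel_measurable N" "(\<lambda>w. snd (z w)) \<in> borel_measurable N"
      by (rule measurable_compose[OF z borel_measurable_fst_snd(1)],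
          rule measurable_compose[OF z borel_measurable_fst_snd(2)])
    have [measurable]: "(\<lambda>w. batch_diff b f j (J w \<inter> {..<m}) (fst (z w)) (snd (z w))) \<in> borel_measurable N"
    proof (rule borel_measurable_batch_diff[where m = m])
      show "(\<lambda>w. J w \<inter> {..<m}) \<in> measurable N (count_space UNIV)"
        by (rule measurable_compose[OF J]) simp
    qed (use differentiable[OF j] in auto)
    show ?thesis unfolding \<psi>_def using j by measurable
  qed
  have R: "insert (Batch i k) (past k) \<subseteq> sources" "{Batch j k} \<subseteq> sources"
    using insert_Batch_past_sources[OF i] j by (auto simp: sources_def)
  have W_info: "W \<in> borel_measurable (info (insert (Batch i k) (past k)))"
    unfolding W_def[abs_def] Z_def
    by (intro borel_measurable_Pair iterate_measurable_info X_Suc_measurable_info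
        batch_err_measurable_info[OF i]) auto
  have W[measurable]: "W \<in> borel_measurable M"
    by (rule measurable_info_imp[OF R(1) W_info])
  \<comment> \<open>\<open>W\<close> carries all of the integrand except the minibatch of j;
    \<open>i \<noteq> j\<close> keeps \<open>Batch j k\<close> out of its sources.\<close>
  have ind: "indep_rv (count_space UNIV) (I j k) borel W"
    by (rule indep_rv_info[OF R(2) R(1) _ batch_measurable_info W_info])
       (use \<open>i \<noteq> j\<close> in \<open>auto simp: past_def\<close>)
  have hm: "(\<lambda>x :: nat set \<times> ((real ^ 'd) \<times> (real ^ 'd)) \<times> (real ^ 'd). \<psi> (fst x) (fst (snd x))) \<in> borel_measurable (count_space UNIV \<Otimes>\<^sub>M borel)"
    by (rule \<psi>_meas[OF measurable_fst measurable_compose[OF measurable_snd borel_measurable_fst_snd(1)]])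
  have sqi: "sq_integrable M (batch_err i k)" and sqj: "sq_integrable M (batch_err j k)"
    using batch_err_sq(1) i j sq_integrable_iterates by auto
  have "(\<integral>w. inner (batch_err i k w) (batch_err j k w) \<partial>M)
      = (\<integral>w. inner (snd (W w)) (\<psi> (I j k w) (fst (W w))) \<partial>M)"
    by (intro Bochner_Integration.integral_cong refl) (simp add: W_def \<psi>_eq)
  also have "\<dots> = (\<integral>w. (\<integral>s. inner (snd s) (\<psi> (I j k w) (fst s)) \<partial>distr M borel W) \<partial>M)"
  proof -
    have "(\<lambda>x :: nat set \<times> ((real ^ 'd) \<times> (real ^ 'd)) \<times> (real ^ 'd). snd (snd x))
        \<in> borel_measurable (count_space UNIV \<Otimes>\<^sub>M borel)"
      by (rule measurable_compose[OF measurable_snd borel_measurable_fst_snd(2)])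
    from borel_measurable_inner[OF this hm]
    have "(\<lambda>x. inner (snd (snd x)) (\<psi> (fst x) (fst (snd x)))) \<in> borel_measurable (count_space UNIV \<Otimes>\<^sub>M borel)" .
    moreover have "integrable M (\<lambda>w. inner (snd (W w)) (\<psi> (I j k w) (fst (W w))))"
      using sq_integrable_inner[OF sqi sqj]
      by (rule Bochner_Integration.integrable_cong[THEN iffD1, OF refl, rotated]) (simp add: W_def \<psi>_eq)
    ultimately show ?thesis
      using indep_rv_integral_iterated(1)[OF ind, of "\<lambda>x. inner (snd (snd x)) (\<psi> (fst x) (fst (snd x)))"]
      by simp
  qed
  also have "\<dots> = 0"
  proof (rule integral_eq_zero_AE)
    have "(\<lambda>x :: nat set \<times> ((real ^ 'd) \<times> (real ^ 'd)) \<times> (real ^ 'd).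
        (norm (\<psi> (fst x) (fst (snd x))))\<^sup>2) \<in> borel_measurable (count_space UNIV \<Otimes>\<^sub>M borel)"
      by (rule borel_measurable_power[OF measurable_compose[OF hm borel_measurable_norm]])
    moreover have "integrable M (\<lambda>w. (norm (\<psi> (I j k w) (fst (W w))))\<^sup>2)"
      using sq_integrableD(2)[OF sqj]
      by (rule Bochner_Integration.integrable_cong[THEN iffD1, OF refl, rotated]) (simp add: W_def \<psi>_eq)
    \<comment> \<open>For a fixed minibatch no assumption bounds this second moment directly, since
      the single component functions are not assumed smooth. Fubini yields it for almost every
      frozen minibatch, which is enough for the outer integral.\<close>
    ultimately have "AE w in M. integrable (distr M borel W) (\<lambda>s. (norm (\<psi> (I j k w) (fst s)))\<^sup>2)"
      using indep_rv_integral_iterated(2)[OF ind, of "\<lambda>x. (norm (\<psi> (fst x) (fst (snd x))))\<^sup>2"]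
      by simp
    then show "AE w in M. (\<integral>s. inner (snd s) (\<psi> (I j k w) (fst s)) \<partial>distr M borel W) = 0"
    proof (rule AE_mp, intro AE_I2 impI)
      fix w
      let ?\<phi> = "\<psi> (I j k w)"
      assume int: "integrable (distr M borel W) (\<lambda>s. (norm (?\<phi> (fst s)))\<^sup>2)"
      have \<phi>[measurable]: "?\<phi> \<in> borel_measurable borel"
        by (rule \<psi>_meas) auto
      have [measurable]: "(\<lambda>s :: ((real ^ 'd) \<times> (real ^ 'd)) \<times> (real ^ 'd). ?\<phi> (fst s)) \<in> borel_measurable borel"
        by (rule measurable_compose[OF borel_measurable_fst_snd(1) \<phi>])
      have [measurable]: "(\<lambda>s :: ((real ^ 'd) \<times> (real ^ 'd)) \<times> (real ^ 'd). snd s) \<in> borel_measurable borel"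
        by (rule borel_measurable_fst_snd(2))
      have "(\<lambda>s :: ((real ^ 'd) \<times> (real ^ 'd)) \<times> (real ^ 'd). inner (snd s) (?\<phi> (fst s))) \<in> borel_measurable borel"
        by (rule borel_measurable_inner) fact+
      note [measurable] = this
      have "integrable M (\<lambda>w'. (norm (?\<phi> (Z w')))\<^sup>2)"
        using int
      proof (subst (asm) integrable_distr_eq[OF W])
        show "(\<lambda>s :: ((real ^ 'd) \<times> (real ^ 'd)) \<times> (real ^ 'd). (norm (?\<phi> (fst s)))\<^sup>2) \<in> borel_measurable borel"
          by (rule borel_measurable_power[OF measurable_compose[OF _ borel_measurable_norm]]) fact
      qed (simp add: W_def)
      moreover have [measurable]: "Z \<in> borel_measurable M" unfolding Z_def[abs_def] by measurable
      ultimately have "sq_integrable M (\<lambda>w'. ?\<phi> (X k w', X (Suc k) w'))"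
        unfolding Z_def[symmetric] by (intro sq_integrableI) auto
      from batch_err_orthogonal[OF i \<phi> this]
      show "(\<integral>s. inner (snd s) (?\<phi> (fst s)) \<partial>distr M borel W) = 0"
        by (subst integral_distr) (auto simp: W_def Z_def)
    qed
  qed
  finally show ?thesis .
qed

text \<open>Everything read before and during round k apart from the coin of round k, which can thus
  be split off by independence.\<close>

definition current :: "nat \<Rightarrow> source set" where
  "current k = past k \<union> {Batch i k | i. i < n} \<union> {Seed i k | i. i < n}"

lemma current_sources: "current k \<subseteq> sources"
  using past_sources[of k] by (auto simp: current_def sources_def)

lemma source_subset_current:
  "i < n \<Longrightarrow> insert (Seed i k) (insert (Batch i k) (past k)) \<subseteq> current k"
  by (auto simp: current_def)

lemma Coin_notin_current: "Coin k \<notin> current k"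
  by (auto simp: current_def past_def)

text \<open>Equals \<open>Q (\<xi> i k w) (Dt i k w) - D i k w\<close>, the deviation of the
  quantized vector from the exact gradient difference.\<close>

definition worker_err :: "nat \<Rightarrow> nat \<Rightarrow> 'w \<Rightarrow> real ^ 'd" where
  "worker_err i k w = batch_err i k w + quant_err i k w"

lemma worker_err_measurable_info:
  "i < n \<Longrightarrow> insert (Seed i k) (insert (Batch i k) (past k)) \<subseteq> R
    \<Longrightarrow> worker_err i k \<in> borel_measurable (info R)"
  unfolding worker_err_def[abs_def]
  by (intro borel_measurable_add batch_err_measurable_info quant_err_measurable_info) auto

lemma sq_integrable_batch_err: "i < n \<Longrightarrow> sq_integrable M (batch_err i k)"
  and sq_integrable_quant_err: "i < n \<Longrightarrow> sq_integrable M (quant_err i k)"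
  by (rule batch_err_sq(1) quant_err_sq(1), assumption, rule sq_integrable_iterates)+

lemma sq_integrable_worker_err: "i < n \<Longrightarrow> sq_integrable M (worker_err i k)"
  unfolding worker_err_def[abs_def]
  by (intro sq_integrable_add sq_integrable_batch_err sq_integrable_quant_err)

lemma quant_err_orthogonal_current:
  assumes "i < n" "sq_integrable M Y" "Y \<in> borel_measurable (info (current k - {Seed i k}))"
  shows "(\<integral>w. inner (quant_err i k w) (Y w) \<partial>M) = 0"
proof (rule quant_err_orthogonal[OF assms(1,2) _ _ assms(3)])
  show "insert (Batch i k) (past k) \<subseteq> current k - {Seed i k}"
    using assms(1) by (auto simp: current_def past_def)
qed (use current_sources in auto)

lemma past_subset_current: "past k \<subseteq> current k - {Seed i k}"
  by (auto simp: current_def past_def)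

text \<open>Origin of the factor \<open>1 + \<omega>\<close>: the minibatch variance counts once by
  itself and \<omega> times more because quantization acts on \<open>Dt i k\<close>, whose second
  moment is that of \<open>D i k\<close> plus this variance.\<close>

lemma integral_worker_err_sq_le:
  assumes i: "i < n"
  shows "(\<integral>w. (norm (worker_err i k w))\<^sup>2 \<partial>M)
      \<le> (\<omega> * (L i)\<^sup>2 + (1 + \<omega>) * (\<L> i)\<^sup>2 / real b) * (\<integral>w. (norm (step k w))\<^sup>2 \<partial>M)"
proof -
  let ?E = "\<lambda>V :: 'w \<Rightarrow> real ^ 'd. \<integral>w. (norm (V w))\<^sup>2 \<partial>M"
  note G = sq_integrable_iterates(2)[of k]
  have "batch_err i k \<in> borel_measurable (info (current k - {Seed i k}))"
    using i by (intro batch_err_measurable_info) (auto simp: current_def past_def)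
  then have "(\<integral>w. inner (quant_err i k w) (batch_err i k w) \<partial>M) = 0"
    by (intro quant_err_orthogonal_current i sq_integrable_batch_err)
  then have 1: "?E (worker_err i k) = ?E (batch_err i k) + ?E (quant_err i k)"
    unfolding worker_err_def
    by (intro pythagoras_integral sq_integrable_batch_err sq_integrable_quant_err i) (simp add: inner_commute)
  have "(\<integral>w. inner (batch_err i k w) (D i k w) \<partial>M) = 0"
  proof -
    define \<phi> where "\<phi> z = grad (local_loss m f i) (snd z) - grad (local_loss m f i) (fst z)"
      for z :: "(real ^ 'd) \<times> (real ^ 'd)"
    have \<phi>: "\<phi> \<in> borel_measurable borel"
      unfolding \<phi>_def[abs_def] using i
      by (intro borel_measurable_diff borel_measurable_fst_snd[THEN measurable_compose] borel_measurable_grad_local)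
    have eq: "D i k = (\<lambda>w. \<phi> (X k w, X (Suc k) w))"
      by (simp add: D \<phi>_def)
    show ?thesis
      unfolding eq by (rule batch_err_orthogonal[OF i \<phi> sq_integrable_D[OF i G, unfolded eq]])
  qed
  then have "(\<integral>w. (norm (batch_err i k w + D i k w))\<^sup>2 \<partial>M) = ?E (batch_err i k) + ?E (D i k)"
    by (intro pythagoras_integral sq_integrable_batch_err sq_integrable_D i G)
  then have 2: "?E (Dt i k) = ?E (batch_err i k) + ?E (D i k)"
    by (simp add: batch_err_def)
  have "?E (worker_err i k) \<le> ?E (batch_err i k) + \<omega> * (?E (batch_err i k) + ?E (D i k))"
    using 1 quant_err_sq(2)[OF i G] unfolding 2 by linarith
  also have "\<dots> = (1 + \<omega>) * ?E (batch_err i k) + \<omega> * ?E (D i k)"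
    by (simp add: algebra_simps)
  also have "\<dots> \<le> (1 + \<omega>) * ((\<L> i)\<^sup>2 / real b * ?E (step k)) + \<omega> * ((L i)\<^sup>2 * ?E (step k))"
    using batch_err_sq(2)[OF i G] integral_D_sq_le[OF i G] \<omega>_pos
    by (intro add_mono mult_left_mono) auto
  also have "\<dots> = (\<omega> * (L i)\<^sup>2 + (1 + \<omega>) * (\<L> i)\<^sup>2 / real b) * ?E (step k)"
    by (simp add: algebra_simps)
  finally show ?thesis .
qed

text \<open>Of the four mixed products, the two with the quantization error of i vanish together, as
  the seed of i is not read by worker j. The other two are treated separately.\<close>

lemma worker_err_pairwise_orthogonal:
  assumes i: "i < n" and j: "j < n" and ij: "i \<noteq> j"
  shows "(\<integral>w. inner (worker_err i k w) (worker_err j k w) \<partial>M) = 0"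
proof -
  have "(\<integral>w. inner (quant_err i k w) (worker_err j k w) \<partial>M) = 0"
    by (intro quant_err_orthogonal_current i j sq_integrable_worker_err worker_err_measurable_info)
       (use i j ij in \<open>auto simp: current_def past_def\<close>)
  moreover have "(\<integral>w. inner (quant_err j k w) (batch_err i k w) \<partial>M) = 0"
    by (intro quant_err_orthogonal_current i j sq_integrable_batch_err batch_err_measurable_info)
       (use i j ij in \<open>auto simp: current_def past_def\<close>)
  moreover have "(\<integral>w. inner (batch_err i k w) (batch_err j k w) \<partial>M) = 0"
    by (rule batch_err_pairwise_orthogonal[OF i j ij])
  moreover have "inner (worker_err i k w) (worker_err j k w) = inner (batch_err i k w) (batch_err j k w)
      + inner (quant_err j k w) (batch_err i k w) + inner (quant_err i k w) (worker_err j k w)" for w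
    by (simp add: worker_err_def inner_add_left inner_add_right inner_commute)
  ultimately show ?thesis
    using i j by (simp add: sq_integrable_inner sq_integrable_batch_err sq_integrable_quant_err sq_integrable_worker_err)
qed

lemma worker_err_err_orthogonal:
  assumes i: "i < n"
  shows "(\<integral>w. inner (err k w) (worker_err i k w) \<partial>M) = 0"
proof -
  have "(\<integral>w. inner (quant_err i k w) (err k w) \<partial>M) = 0"
    by (intro quant_err_orthogonal_current i sq_integrable_err err_measurable_info past_subset_current)
  moreover have "(\<integral>w. inner (batch_err i k w) (err k w) \<partial>M) = 0"
  proof -
    \<comment> \<open>the conditioning is on the two iterates only, but these determine the direction\<close>
    define \<phi> where "\<phi> z = (1 / \<gamma>) *\<^sub>R (fst z - snd z) - grad (global_loss n m f) (fst z)"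
      for z :: "(real ^ 'd) \<times> (real ^ 'd)"
    have \<phi>: "\<phi> \<in> borel_measurable borel"
      unfolding \<phi>_def[abs_def]
      by (intro borel_measurable_diff borel_measurable_scaleR borel_measurable_const
          borel_measurable_fst_snd borel_measurable_fst_snd[THEN measurable_compose] borel_measurable_grad_global)
    have eq: "err k = (\<lambda>w. \<phi> (X k w, X (Suc k) w))"
      using \<gamma>_pos by (simp add: fun_eq_iff err_def X_Suc \<phi>_def)
    show ?thesis
      unfolding eq by (rule batch_err_orthogonal[OF i \<phi> sq_integrable_err[of k, unfolded eq]])
  qed
  moreover have "inner (err k w) (worker_err i k w) = inner (batch_err i k w) (err k w)
      + inner (quant_err i k w) (err k w)" for w
    by (simp add: worker_err_def inner_add_left inner_add_right inner_commute)
  ultimately show ?thesis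
    using i by (simp add: sq_integrable_inner sq_integrable_batch_err sq_integrable_quant_err sq_integrable_err)
qed

subsection \<open>Variance recursion\<close>

lemma integral_coin_indicator:
  fixes Y :: "'w \<Rightarrow> real"
  assumes "R \<subseteq> sources" "Coin k \<notin> R" "Y \<in> borel_measurable (info R)" "integrable M Y"
  shows "(\<integral>w. of_bool (c k w) * Y w \<partial>M) = p * (\<integral>w. Y w \<partial>M)"
    and "(\<integral>w. of_bool (\<not> c k w) * Y w \<partial>M) = (1 - p) * (\<integral>w. Y w \<partial>M)"
    and "integrable M (\<lambda>w. of_bool (c k w) * Y w)"
    and "integrable M (\<lambda>w. of_bool (\<not> c k w) * Y w)"
proof -
  have ind: "indep_rv borel Y (count_space UNIV) (c k)"
    by (rule indep_rv_info[of R "{Coin k}"])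
       (use assms coin_measurable_info[of k "{Coin k}"] in \<open>auto simp: sources_def\<close>)
  have [simp]: "indicator {True} = (of_bool :: bool \<Rightarrow> real)" "indicator {False} = (\<lambda>x. of_bool (\<not> x) :: real)"
    by (auto simp: indicator_def)
  note * = indep_rv_integral_indicator[OF ind assms(4), of "{True}"]
    indep_rv_integral_indicator[OF ind assms(4), of "{False}"]
  show "(\<integral>w. of_bool (c k w) * Y w \<partial>M) = p * (\<integral>w. Y w \<partial>M)"
    and "(\<integral>w. of_bool (\<not> c k w) * Y w \<partial>M) = (1 - p) * (\<integral>w. Y w \<partial>M)"
    and "integrable M (\<lambda>w. of_bool (c k w) * Y w)"
    and "integrable M (\<lambda>w. of_bool (\<not> c k w) * Y w)"
    using * prob by (simp_all add: coin_distr measure_pmf_single)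
qed

lemma err_Suc: "err (Suc k) w = of_bool (\<not> c k w) *\<^sub>R (err k w + (1 / real n) *\<^sub>R (\<Sum>i<n. worker_err i k w))"
proof (cases "c k w")
  case True
  then show ?thesis by (simp add: err_def G_Suc)
next
  case False
  have "(\<Sum>i<n. worker_err i k w) = (\<Sum>i<n. Q (\<xi> i k w) (Dt i k w)) - (\<Sum>i<n. D i k w)"
    by (simp add: worker_err_def batch_err_def quant_err_def flip: sum_subtractf)
  \<comment> \<open>The exact differences average to the change of the full gradient, which is what
    the target of the estimator moves by.\<close>
  moreover have "(1 / real n) *\<^sub>R (\<Sum>i<n. D i k w)
      = grad (global_loss n m f) (X (Suc k) w) - grad (global_loss n m f) (X k w)"
    by (simp add: D grad_global_loss sum_subtractf scaleR_diff_right)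
  ultimately show ?thesis
    using False by (simp add: err_def G_Suc scaleR_diff_right)
qed

definition noise :: real where
  "noise = (\<omega> * (rms n L)\<^sup>2 + (1 + \<omega>) * (rms n \<L>)\<^sup>2 / real b) / real n"

lemma noise_nonneg: "0 \<le> noise"
  using \<omega>_pos by (simp add: noise_def)

lemma variance_recursion:
  "(\<integral>w. (norm (err (Suc k) w))\<^sup>2 \<partial>M)
    \<le> (1 - p) * ((\<integral>w. (norm (err k w))\<^sup>2 \<partial>M) + noise * (\<integral>w. (norm (step k w))\<^sup>2 \<partial>M))"
proof -
  let ?E = "\<lambda>V :: 'w \<Rightarrow> real ^ 'd. \<integral>w. (norm (V w))\<^sup>2 \<partial>M"
  define U where "U w = (\<Sum>i<n. worker_err i k w)" for w
  define V where "V w = err k w + (1 / real n) *\<^sub>R U w" for w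
  have U: "sq_integrable M U"
    unfolding U_def[abs_def] by (intro sq_integrable_sum sq_integrable_worker_err) auto
  have V: "sq_integrable M V"
    unfolding V_def[abs_def] by (intro sq_integrable_add sq_integrable_scaleR U sq_integrable_err)
  have [measurable]: "err k \<in> borel_measurable (info (current k))" "U \<in> borel_measurable (info (current k))"
    unfolding U_def[abs_def] using past_subset_current
    by (auto intro!: err_measurable_info borel_measurable_sum worker_err_measurable_info source_subset_current)
  have "V \<in> borel_measurable (info (current k))"
    unfolding V_def[abs_def] by measurable
  then have "(\<lambda>w. (norm (V w))\<^sup>2) \<in> borel_measurable (info (current k))"
    by measurable
  from integral_coin_indicator(2)[OF current_sources Coin_notin_current this sq_integrableD(2)[OF V]]
  have "(\<integral>w. of_bool (\<not> c k w) * (norm (V w))\<^sup>2 \<partial>M) = (1 - p) * ?E V" .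
  moreover have "(norm (err (Suc k) w))\<^sup>2 = of_bool (\<not> c k w) * (norm (V w))\<^sup>2" for w
    by (simp add: err_Suc V_def U_def)
  ultimately have "?E (err (Suc k)) = (1 - p) * ?E V" by simp
  moreover have "?E V = ?E (err k) + (1 / real n)\<^sup>2 * ?E U"
  proof -
    have "(\<integral>w. inner (err k w) (U w) \<partial>M) = 0"
      unfolding U_def
      by (rule orthogonal_sum_integral) (auto intro: sq_integrable_worker_err sq_integrable_err worker_err_err_orthogonal)
    then have "?E V = ?E (err k) + (\<integral>w. (norm ((1 / real n) *\<^sub>R U w))\<^sup>2 \<partial>M)"
      unfolding V_def by (intro pythagoras_integral sq_integrable_err sq_integrable_scaleR U) simp
    then show ?thesis by (simp add: power_divide)
  qed
  moreover have "?E U = (\<Sum>i<n. ?E (worker_err i k))"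
    unfolding U_def
    by (rule pythagoras_sum_integral) (auto intro: sq_integrable_worker_err worker_err_pairwise_orthogonal)
  \<comment> \<open>Pairwise orthogonality leaves the factor 1/n squared before a plain sum. One 1/n
    forms the means of squares inside \<open>rms\<close>, the other is the gain from n workers kept
    in \<open>noise\<close>.\<close>
  moreover have "(1 / real n)\<^sup>2 * (\<Sum>i<n. ?E (worker_err i k)) \<le> noise * ?E (step k)"
  proof -
    have "(1 / real n)\<^sup>2 * (\<Sum>i<n. ?E (worker_err i k))
        \<le> (1 / real n)\<^sup>2 * (\<Sum>i<n. (\<omega> * (L i)\<^sup>2 + (1 + \<omega>) * (\<L> i)\<^sup>2 / real b) * ?E (step k))"
      by (intro mult_left_mono sum_mono integral_worker_err_sq_le) auto
    also have "(\<Sum>i<n. (\<omega> * (L i)\<^sup>2 + (1 + \<omega>) * (\<L> i)\<^sup>2 / real b) * ?E (step k))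
        = (\<omega> * (\<Sum>i<n. (L i)\<^sup>2) + (1 + \<omega>) * (\<Sum>i<n. (\<L> i)\<^sup>2) / real b) * ?E (step k)"
      by (simp add: sum.distrib flip: sum_distrib_right sum_distrib_left sum_divide_distrib)
    also have "(1 / real n)\<^sup>2 * \<dots> = noise * ?E (step k)"
      unfolding noise_def rms_sq by (simp add: power_divide power2_eq_square algebra_simps add_divide_distrib)
    finally show ?thesis .
  qed
  ultimately show ?thesis
    using prob by (simp add: mult_left_mono)
qed

subsection \<open>The Lyapunov function\<close>

definition gap :: "nat \<Rightarrow> 'w \<Rightarrow> real" where
  "gap k w = global_loss n m f (X k w) - fstar"

lemma gap_nonneg: "0 \<le> gap k w"
  using lower_bound by (simp add: gap_def)

lemma gap_Suc_le:
  "gap (Suc k) w \<le> gap k w - \<gamma> / 2 * (norm (grad (global_loss n m f) (X k w)))\<^sup>2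
     - (1 / (2 * \<gamma>) - rms n L / 2) * (norm (step k w))\<^sup>2 + \<gamma> / 2 * (norm (err k w))\<^sup>2"
  using lyapunov_decrease[OF global_loss_differentiable smooth_global_loss \<gamma>_pos X_Suc[of k w]]
  by (simp add: gap_def step_def err_def)

text \<open>The gap lies between 0 and the right-hand side of \<open>gap_Suc_le\<close>, which is
  integrable by induction and the second moments.\<close>

lemma integrable_gap: "integrable M (gap k)"
proof (induction k)
  case 0
  show ?case by (simp add: gap_def X_0)
next
  case (Suc k)
  have "continuous_on UNIV (global_loss n m f)"
    using global_loss_differentiable
    by (simp add: continuous_at_imp_continuous_on differentiable_imp_continuous_within)
  then have [measurable]: "global_loss n m f \<in> borel_measurable borel"
    by (rule borel_measurable_continuous_onI)
  let ?B = "\<lambda>w. gap k w - \<gamma> / 2 * (norm (grad (global_loss n m f) (X k w)))\<^sup>2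
     - (1 / (2 * \<gamma>) - rms n L / 2) * (norm (step k w))\<^sup>2 + \<gamma> / 2 * (norm (err k w))\<^sup>2"
  show ?case
  proof (rule Bochner_Integration.integrable_bound)
    show "integrable M ?B"
      using Suc sq_integrableD(2)[OF sq_integrable_grad_global[OF sq_integrable_iterates(1)[of k]]]
        sq_integrableD(2)[OF sq_integrable_step[OF sq_integrable_iterates(2)[of k]]]
        sq_integrableD(2)[OF sq_integrable_err[of k]] by simp
    show "gap (Suc k) \<in> borel_measurable M" unfolding gap_def[abs_def] by measurable
    show "AE w in M. norm (gap (Suc k) w) \<le> norm (?B w)"
      using gap_Suc_le gap_nonneg by (intro AE_I2) (smt (verit) real_norm_def)
  qed
qed

text \<open>Up to this point the stepsize is only known to be positive; its upper bound enters here.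
  The one-step decrease telescopes and the final value of the Lyapunov function is
  nonnegative.\<close>

lemma sum_integral_grad_le:
  assumes stepsize: "\<gamma> * (rms n L + sqrt ((1 - p) / p * noise)) \<le> 1"
  shows "(\<Sum>k<K. \<integral>w. (norm (grad (global_loss n m f) (X k w)))\<^sup>2 \<partial>M)
    \<le> 2 * (global_loss n m f x0 - fstar) / \<gamma>"
proof -
  define F where "F k = (\<integral>w. gap k w \<partial>M)" for k
  define g where "g k = (\<integral>w. (norm (grad (global_loss n m f) (X k w)))\<^sup>2 \<partial>M)" for k
  define s where "s k = (\<integral>w. (norm (step k w))\<^sup>2 \<partial>M)" for k
  define v where "v k = (\<integral>w. (norm (err k w))\<^sup>2 \<partial>M)" for k
  \<comment> \<open>The weight solves \<open>(1 - p) * \<gamma> / (2 * p) + \<gamma> / 2 = \<gamma>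
    / (2 * p)\<close>: the contraction of the variance pays exactly for the error term of the
    descent step. The squared step keeps minus half the coefficient of
    \<open>stepsize_coefficient_nonneg\<close> for \<open>C = (1 - p) / p * noise\<close>.\<close>
  define \<Phi> where "\<Phi> k = F k + \<gamma> / (2 * p) * v k" for k
  have F: "F (Suc k) \<le> F k - \<gamma> / 2 * g k - (1 / (2 * \<gamma>) - rms n L / 2) * s k + \<gamma> / 2 * v k" for k
  proof -
    have "F (Suc k) \<le> (\<integral>w. gap k w - \<gamma> / 2 * (norm (grad (global_loss n m f) (X k w)))\<^sup>2
       - (1 / (2 * \<gamma>) - rms n L / 2) * (norm (step k w))\<^sup>2 + \<gamma> / 2 * (norm (err k w))\<^sup>2 \<partial>M)"
      unfolding F_def
      using sq_integrableD(2)[OF sq_integrable_grad_global[OF sq_integrable_iterates(1)[of k]]]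
        sq_integrableD(2)[OF sq_integrable_step[OF sq_integrable_iterates(2)[of k]]]
        sq_integrableD(2)[OF sq_integrable_err[of k]]
      by (intro integral_mono integrable_gap gap_Suc_le) (simp add: integrable_gap)
    also have "\<dots> = F k - \<gamma> / 2 * g k - (1 / (2 * \<gamma>) - rms n L / 2) * s k + \<gamma> / 2 * v k"
      unfolding F_def g_def s_def v_def
      using sq_integrableD(2)[OF sq_integrable_grad_global[OF sq_integrable_iterates(1)[of k]]]
        sq_integrableD(2)[OF sq_integrable_step[OF sq_integrable_iterates(2)[of k]]]
        sq_integrableD(2)[OF sq_integrable_err[of k]] integrable_gap[of k]
      by simp
    finally show ?thesis .
  qed
  have step: "\<Phi> (Suc k) \<le> \<Phi> k - \<gamma> / 2 * g k" for k
  proof -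
    have "0 \<le> 1 / \<gamma> - rms n L - \<gamma> * ((1 - p) / p * noise)"
      using stepsize noise_nonneg prob by (intro stepsize_coefficient_nonneg \<gamma>_pos rms_sq) auto
    then have "0 \<le> (1 / \<gamma> - rms n L - \<gamma> * ((1 - p) / p * noise)) / 2 * s k"
      by (simp add: s_def)
    moreover have "\<gamma> / (2 * p) * v (Suc k) \<le> \<gamma> / (2 * p) * ((1 - p) * (v k + noise * s k))"
      unfolding v_def s_def using variance_recursion[of k] \<gamma>_pos prob by (intro mult_left_mono) auto
    moreover have "\<gamma> / (2 * p) * ((1 - p) * (v k + noise * s k))
        = \<gamma> / (2 * p) * v k - \<gamma> / 2 * v k + \<gamma> * ((1 - p) / p * noise) / 2 * s k"
      using prob by (simp add: field_simps)
    moreover have "(1 / \<gamma> - rms n L - \<gamma> * ((1 - p) / p * noise)) / 2 * s k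
        = (1 / (2 * \<gamma>) - rms n L / 2) * s k - \<gamma> * ((1 - p) / p * noise) / 2 * s k"
      by (simp only: diff_divide_distrib left_diff_distrib divide_divide_eq_left mult.commute[of 2 \<gamma>])
    ultimately show ?thesis
      using F[of k] unfolding \<Phi>_def by linarith
  qed
  have "\<gamma> / 2 * (\<Sum>k<K. g k) \<le> \<Phi> 0 - \<Phi> K"
  proof (induction K)
    case (Suc K)
    then show ?case using step[of K] by (simp add: algebra_simps)
  qed simp
  moreover have "0 \<le> \<Phi> K"
    unfolding \<Phi>_def F_def v_def using gap_nonneg \<gamma>_pos prob by simp
  \<comment> \<open>The run starts from the exact gradient, so the initial value contains no error
    term.\<close>
  moreover have "\<Phi> 0 = global_loss n m f x0 - fstar"
    by (simp add: \<Phi>_def F_def v_def gap_def err_def X_0 G_0 prob_space)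
  ultimately have "\<gamma> / 2 * (\<Sum>k<K. g k) \<le> global_loss n m f x0 - fstar" by linarith
  then show ?thesis
    using \<gamma>_pos by (simp add: g_def field_simps)
qed

end

section \<open>Number of nonzero components\<close>

lemma borel_measurable_l0_norm: "(\<lambda>y :: real ^ 'd. real (l0_norm y)) \<in> borel_measurable borel"
proof -
  have "(\<lambda>y :: real ^ 'd. \<Sum>l\<in>UNIV. of_bool (y $ l \<noteq> 0) :: real) \<in> borel_measurable borel"
  proof (intro borel_measurable_sum)
    fix l :: 'd
    have "(\<lambda>t :: real. of_bool (t \<noteq> 0) :: real) \<in> borel_measurable borel"
      by measurable
    with borel_measurable_component[of l]
    show "(\<lambda>y :: real ^ 'd. of_bool (y $ l \<noteq> 0) :: real) \<in> borel_measurable borel"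
      by (rule measurable_compose)
  qed
  moreover have "real (l0_norm y) = (\<Sum>l\<in>UNIV. of_bool (y $ l \<noteq> 0))" for y :: "real ^ 'd"
    by (simp add: l0_norm_def of_bool_def sum.If_cases)
  ultimately show ?thesis by simp
qed

lemma l0_norm_le: "l0_norm (y :: real ^ 'd) \<le> CARD('d)"
  unfolding l0_norm_def by (rule card_mono) auto

context vr_marina_run
begin

subsection \<open>The returned point\<close>

text \<open>The index is independent of the sources of each iterate, so splitting by its value gives
  every iterate the weight 1/K.\<close>

lemma returned_point:
  assumes K: "1 \<le> K"
  shows "integrable M (\<lambda>w. (norm (grad (global_loss n m f) (X (pick K w) w)))\<^sup>2)"
    and "(\<integral>w. (norm (grad (global_loss n m f) (X (pick K w) w)))\<^sup>2 \<partial>M)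
      = (\<Sum>k<K. \<integral>w. (norm (grad (global_loss n m f) (X k w)))\<^sup>2 \<partial>M) / real K"
proof -
  let ?h = "\<lambda>k w. (norm (grad (global_loss n m f) (X k w)))\<^sup>2"
  have [measurable]: "pick K \<in> measurable M (count_space UNIV)" by (rule pick_measurable[OF K])
  have nonempty: "{..<K} \<noteq> {}" using K by (auto simp: lessThan_empty_iff)
  have int: "integrable M (?h k)" for k
    by (rule sq_integrableD(2)[OF sq_integrable_grad_global[OF sq_integrable_iterates(1)]])
  have ind: "indep_rv borel (?h k) (count_space UNIV) (pick K)" for k
  proof (rule indep_rv_info[of "past k" "{Pick K}"])
    show "past k \<inter> {Pick K} = {}" by (auto simp: past_def)
    show "?h k \<in> borel_measurable (info (past k))"
      using iterate_measurable_info(1)[of k "past k"] by measurable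
  qed (use K past_sources pick_measurable_info in \<open>auto simp: sources_def\<close>)
  have prob_pick: "measure (distr M (count_space UNIV) (pick K)) {k} = 1 / real K" if "k < K" for k
    using that nonempty by (simp add: pick_distr[OF K] measure_pmf_single)
  note * = indep_rv_integral_indicator[OF ind int]
  \<comment> \<open>Only the law of the index is given, so it lies in range almost surely rather
    than everywhere.\<close>
  have "AE w in M. pick K w < K"
  proof -
    have "AE k in distr M (count_space UNIV) (pick K). k < K"
      unfolding pick_distr[OF K] using nonempty by (simp add: AE_measure_pmf_iff)
    then show ?thesis by (subst (asm) AE_distr_iff) auto
  qed
  then have AE: "AE w in M. ?h (pick K w) w = (\<Sum>k<K. indicator {k} (pick K w) * ?h k w)"
  proof (rule AE_mp, intro AE_I2 impI)
    fix w assume "pick K w < K"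
    then show "?h (pick K w) w = (\<Sum>k<K. indicator {k} (pick K w) * ?h k w)"
      by (simp add: indicator_def of_bool_def if_distrib[of "\<lambda>x. x * _"] sum.delta cong: if_cong)
  qed
  have m1: "(\<lambda>w. ?h (pick K w) w) \<in> borel_measurable M"
    by (rule measurable_compose_countable[where f = ?h]) measurable
  have ints: "integrable M (\<lambda>w. \<Sum>k<K. indicator {k} (pick K w) * ?h k w)"
    using *(2) by (intro Bochner_Integration.integrable_sum) auto
  show "integrable M (\<lambda>w. ?h (pick K w) w)"
    using ints integrable_cong_AE[OF m1 borel_measurable_integrable[OF ints] AE] by blast
  have "(\<integral>w. ?h (pick K w) w \<partial>M) = (\<integral>w. (\<Sum>k<K. indicator {k} (pick K w) * ?h k w) \<partial>M)"
    by (rule integral_cong_AE[OF m1 borel_measurable_integrable[OF ints] AE])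
  also have "\<dots> = (\<Sum>k<K. \<integral>w. indicator {k} (pick K w) * ?h k w \<partial>M)"
    using *(2) by (intro Bochner_Integration.integral_sum) auto
  also have "\<dots> = (\<Sum>k<K. 1 / real K * (\<integral>w. ?h k w \<partial>M))"
    using *(1) prob_pick by (intro sum.cong) auto
  finally show "(\<integral>w. ?h (pick K w) w \<partial>M) = (\<Sum>k<K. \<integral>w. ?h k w \<partial>M) / real K"
    by (simp add: sum_divide_distrib)
qed

subsection \<open>Oracle calls and communication\<close>

lemma integral_coin:
  "(\<integral>w. (if c k w then s else t) \<partial>M) = p * s + (1 - p) * t"
  "integrable M (\<lambda>w. if c k w then s else t :: real)"
proof -
  \<comment> \<open>A constant reads no source, so the coin lemma applies with the empty
    set.\<close>
  have one: "(\<lambda>w. 1 :: real) \<in> borel_measurable (info {})" "integrable M (\<lambda>w. 1 :: real)"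
    by auto
  note * = integral_coin_indicator[of "{}" k "\<lambda>_. 1", OF _ _ one]
  have "(if c k w then s else t) = s * of_bool (c k w) + t * of_bool (\<not> c k w)" for w
    by simp
  then show "(\<integral>w. (if c k w then s else t) \<partial>M) = p * s + (1 - p) * t"
    and "integrable M (\<lambda>w. if c k w then s else t :: real)"
    using * by (simp_all add: prob_space mult.commute)
qed

text \<open>Minibatches have the fixed size b, so the number of calls is a function of the coins
  alone; a minibatch round evaluates each chosen component at both iterates.\<close>

lemma expected_calls:
  assumes i: "i < n"
  shows "(\<integral>w. real (oracle_calls m (\<lambda>k. c k w) (\<lambda>i k. I i k w) i K) \<partial>M)
    = real m + real K * (p * real m + 2 * (1 - p) * real b)"
proof -
  have "real (oracle_calls m (\<lambda>k. c k w) (\<lambda>i k. I i k w) i K)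
      = real m + (\<Sum>k<K. if c k w then real m else 2 * real b)" if "w \<in> space M" for w
  proof -
    have queries: "real (card (step_queries m (c k w) (I i k w) k)) = (if c k w then real m else 2 * real b)" for k
      using batch_card[OF i that, of k]
      by (simp add: step_queries_def card_cartesian_product)
    show ?thesis
      unfolding oracle_calls_def of_nat_add of_nat_sum queries
      by (simp add: initial_queries_def card_cartesian_product)
  qed
  then have "(\<integral>w. real (oracle_calls m (\<lambda>k. c k w) (\<lambda>i k. I i k w) i K) \<partial>M)
      = (\<integral>w. real m + (\<Sum>k<K. if c k w then real m else 2 * real b) \<partial>M)"
    by (intro Bochner_Integration.integral_cong) auto
  also have "\<dots> = real m + (\<Sum>k<K. p * real m + (1 - p) * (2 * real b))"
    using integral_coin by (simp add: prob_space)
  finally show ?thesis by simp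
qed

abbreviation message :: "nat \<Rightarrow> nat \<Rightarrow> 'w \<Rightarrow> (real ^ 'd) message" where
  "message i t w \<equiv> message_of m b f Q (\<lambda>k. X k w) (\<lambda>k. c k w) (\<lambda>i k. I i k w) (\<lambda>i k. \<xi> i k w) i t"

text \<open>The charge looks only at the constructor of a message and hence only at the coin.
  Message 0 is always dense and accounts for the separate d.\<close>

lemma expected_charge:
  "(\<integral>w. (\<Sum>t\<le>K. charge z (message i t w)) \<partial>M)
    = real CARD('d) + real K * (p * real CARD('d) + (1 - p) * z)"
proof -
  have "charge z (message i (Suc k) w) = (if c k w then real CARD('d) else z)" for k w
    by simp
  then have "(\<integral>w. (\<Sum>t\<le>K. charge z (message i t w)) \<partial>M)
      = (\<integral>w. real CARD('d) + (\<Sum>k<K. if c k w then real CARD('d) else z) \<partial>M)"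
    by (simp add: sum.atMost_shift)
  also have "\<dots> = real CARD('d) + (\<Sum>k<K. p * real CARD('d) + (1 - p) * z)"
    using integral_coin by (simp add: prob_space)
  finally show ?thesis by simp
qed

text \<open>A vector has at most d nonzero components, so the real supremum is taken over a nonempty
  set bounded above.\<close>

lemma density_bounds:
  shows "(\<integral>s. real (l0_norm (Q s x)) \<partial>S) \<le> expected_density S Q"
    and "expected_density S Q \<le> real CARD('d)" and "0 \<le> expected_density S Q"
proof -
  interpret S: prob_space S using quantization by (simp add: quantization_operator_def)
  have le: "(\<integral>s. real (l0_norm (Q s x)) \<partial>S) \<le> real CARD('d)" for x
  proof -
    have "(\<integral>s. real (l0_norm (Q s x)) \<partial>S) \<le> (\<integral>s. real CARD('d) \<partial>S)"
      by (rule integral_mono_AE') (auto simp: l0_norm_le)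
    then show ?thesis by (simp add: S.prob_space)
  qed
  show *: "(\<integral>s. real (l0_norm (Q s x)) \<partial>S) \<le> expected_density S Q" for x
    unfolding expected_density_def by (rule cSUP_upper) (auto intro!: bdd_aboveI2 le)
  show "expected_density S Q \<le> real CARD('d)"
    unfolding expected_density_def by (rule cSUP_least) (auto intro: le)
  have "0 \<le> (\<integral>s. real (l0_norm (Q s 0)) \<partial>S)" by simp
  also note *
  finally show "0 \<le> expected_density S Q" .
qed

text \<open>Gradients get the bound d. For a quantized message the coin splits off as
  \<open>1 - p\<close>; then the argument is frozen, and the average over the seed is at most the
  supremum defining the density.\<close>

lemma message_nonzeros:
  assumes i: "i < n"
  shows "integrable M (\<lambda>w. nonzeros (message i (Suc k) w))"
    and "(\<integral>w. nonzeros (message i (Suc k) w) \<partial>M) \<le> p * real CARD('d) + (1 - p) * expected_density S Q"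
proof -
  have integrable_l0: "integrable M (\<lambda>w. real (l0_norm (V w)))"
    if "V \<in> borel_measurable M" for V :: "'w \<Rightarrow> real ^ 'd"
    using that by (intro integrable_const_bound[of _ "real CARD('d)"])
      (auto simp: l0_norm_le intro: measurable_compose[OF _ borel_measurable_l0_norm])
  define R where "R = insert (Seed i k) (insert (Batch i k) (past k))"
  have R: "R \<subseteq> sources" "Coin k \<notin> R"
    unfolding R_def using insert_Seed_past_sources[OF i] by (auto simp: past_def)
  have qm: "(\<lambda>w. Q (\<xi> i k w) (Dt i k w)) \<in> borel_measurable (info R)"
    unfolding R_def by (rule quantized_measurable_info[OF i]) simp
  note qM[measurable] = measurable_info_imp[OF R(1) qm]
  have gM: "(\<lambda>w. grad (local_loss m f i) (X (Suc k) w)) \<in> borel_measurable M"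
    using i by measurable
  let ?q = "\<lambda>w. real (l0_norm (Q (\<xi> i k w) (Dt i k w)))"
  let ?g = "\<lambda>w. real (l0_norm (grad (local_loss m f i) (X (Suc k) w)))"
  have eq: "nonzeros (message i (Suc k) w) = of_bool (c k w) * ?g w + of_bool (\<not> c k w) * ?q w" for w
    by (simp add: Dt)
  have int_q: "integrable M ?q" by (rule integrable_l0[OF qM])
  have int_g: "integrable M (\<lambda>w. of_bool (c k w) * ?g w)"
    by (rule Bochner_Integration.integrable_bound[OF integrable_l0[OF gM]])
       (use borel_measurable_integrable[OF integrable_l0[OF gM]] in \<open>auto\<close>)
  have "?q \<in> borel_measurable (info R)"
    by (rule measurable_compose[OF qm borel_measurable_l0_norm])
  note q = integral_coin_indicator(2,4)[OF R this int_q]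
  show "integrable M (\<lambda>w. nonzeros (message i (Suc k) w))"
    unfolding eq by (intro Bochner_Integration.integrable_add int_g q(2))
  have "(\<integral>w. of_bool (c k w) * ?g w \<partial>M) \<le> (\<integral>w. (if c k w then real CARD('d) else 0) \<partial>M)"
    by (rule integral_mono[OF int_g integral_coin(2)]) (auto simp: l0_norm_le)
  also have "\<dots> = p * real CARD('d)" by (simp add: integral_coin)
  finally have g: "(\<integral>w. of_bool (c k w) * ?g w \<partial>M) \<le> p * real CARD('d)" .
  have hm: "(\<lambda>z. real (l0_norm (Q (snd z) (fst z)))) \<in> borel_measurable (borel \<Otimes>\<^sub>M S)"
    by (rule measurable_compose[OF _ borel_measurable_l0_norm])
       (rule quantization_measurable[OF quantization measurable_snd measurable_fst])
  note it = indep_rv_integral_iterated[OF Dt_seed_indep[OF i] hm, simplified, OF int_q, unfolded seed_distr[OF i]]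
  have "(\<integral>w. ?q w \<partial>M) \<le> (\<integral>w. expected_density S Q \<partial>M)"
    unfolding it(1) by (intro integral_mono it(3)) (auto intro: density_bounds)
  then have "(\<integral>w. ?q w \<partial>M) \<le> expected_density S Q" by (simp add: prob_space)
  then have "(1 - p) * (\<integral>w. ?q w \<partial>M) \<le> (1 - p) * expected_density S Q"
    using prob by (intro mult_left_mono) auto
  with g q show "(\<integral>w. nonzeros (message i (Suc k) w) \<partial>M)
      \<le> p * real CARD('d) + (1 - p) * expected_density S Q"
    unfolding eq using int_g by simp
qed

lemma expected_nonzeros:
  assumes i: "i < n"
  shows "integrable M (\<lambda>w. \<Sum>t\<le>K. nonzeros (message i t w))"
    and "(\<integral>w. (\<Sum>t\<le>K. nonzeros (message i t w)) \<partial>M)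
      \<le> real CARD('d) + real K * (p * real CARD('d) + (1 - p) * expected_density S Q)"
proof -
  have eq: "(\<Sum>t\<le>K. nonzeros (message i t w))
      = real (l0_norm (grad (local_loss m f i) x0)) + (\<Sum>k<K. nonzeros (message i (Suc k) w))" for w
    by (simp add: sum.atMost_shift X_0 del: message_of.simps(2))
  show "integrable M (\<lambda>w. \<Sum>t\<le>K. nonzeros (message i t w))"
    unfolding eq using message_nonzeros(1)[OF i]
    by (intro Bochner_Integration.integrable_add Bochner_Integration.integrable_sum) auto
  have "(\<integral>w. (\<Sum>t\<le>K. nonzeros (message i t w)) \<partial>M)
      = real (l0_norm (grad (local_loss m f i) x0)) + (\<Sum>k<K. \<integral>w. nonzeros (message i (Suc k) w) \<partial>M)"
    unfolding eq using message_nonzeros(1)[OF i] by (simp add: prob_space del: message_of.simps(2))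
  also have "\<dots> \<le> real CARD('d) + (\<Sum>k<K. p * real CARD('d) + (1 - p) * expected_density S Q)"
    using message_nonzeros(2)[OF i] by (intro add_mono sum_mono) (auto simp: l0_norm_le simp del: message_of.simps(2))
  finally show "(\<integral>w. (\<Sum>t\<le>K. nonzeros (message i t w)) \<partial>M)
      \<le> real CARD('d) + real K * (p * real CARD('d) + (1 - p) * expected_density S Q)" by simp
qed

text \<open>Allows the cost of minibatches in one surplus iteration to be absorbed into m in the
  oracle bound.\<close>

lemma batch_size_le: "b \<le> m"
proof -
  obtain w where "w \<in> space M" using not_empty by blast
  then have "card (I 0 0 w) = b" "I 0 0 w \<subseteq> {..<m}"
    using sizes(1) batch_card[of 0 w 0] batch_subset[of 0 w 0] by auto
  then show ?thesis using card_mono[of "{..<m}" "I 0 0 w"] by simp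
qed

end

section \<open>Iteration, oracle and communication bounds\<close>

lemma ceiling_at_least_one:
  fixes y :: real
  assumes "0 \<le> y"
  obtains K :: nat where "1 \<le> K" "real K \<le> y + 1" "y \<le> real K"
proof
  \<comment> \<open>The maximum acts only at y = 0, where the ceiling is 0 although an iterate can
    be returned only for K \<ge> 1.\<close>
  show "1 \<le> max 1 (nat \<lceil>y\<rceil>)" by simp
  show "real (max 1 (nat \<lceil>y\<rceil>)) \<le> y + 1" using assms by linarith
  show "y \<le> real (max 1 (nat \<lceil>y\<rceil>))" by linarith
qed


theorem theoremD1:
  fixes f :: "nat \<Rightarrow> nat \<Rightarrow> real ^ 'd \<Rightarrow> real"
    and n m b :: nat
    and M :: "'w measure"
    and S :: "'s measure" and Q :: "'s \<Rightarrow> real ^ 'd \<Rightarrow> real ^ 'd"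
    and c :: "nat \<Rightarrow> 'w \<Rightarrow> bool" and I :: "nat \<Rightarrow> nat \<Rightarrow> 'w \<Rightarrow> nat set"
    and \<xi> :: "nat \<Rightarrow> nat \<Rightarrow> 'w \<Rightarrow> 's" and pick :: "nat \<Rightarrow> 'w \<Rightarrow> nat"
    and x0 :: "real ^ 'd" and \<gamma> p \<omega> \<zeta> fstar Lbar \<L>bar A \<Delta>0 :: real
    and L \<L> :: "nat \<Rightarrow> real"
    and X :: "nat \<Rightarrow> 'w \<Rightarrow> real ^ 'd" and xhat :: "nat \<Rightarrow> 'w \<Rightarrow> real ^ 'd"
    and D Dt :: "nat \<Rightarrow> nat \<Rightarrow> 'w \<Rightarrow> real ^ 'd"
    and calls :: "nat \<Rightarrow> nat \<Rightarrow> 'w \<Rightarrow> real" and msg :: "nat \<Rightarrow> nat \<Rightarrow> 'w \<Rightarrow> (real ^ 'd) message"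
  assumes sizes: "1 \<le> n" "1 \<le> m" "1 \<le> b"
    and differentiable: "\<And>i j x. i < n \<Longrightarrow> j < m \<Longrightarrow> f i j differentiable (at x)"
    and lower_bound: "\<And>x. fstar \<le> global_loss n m f x"
    and smooth: "\<And>i. i < n \<Longrightarrow> smooth_with (L i) (local_loss m f i)"
    and quantization: "quantization_operator S Q \<omega>"
    and density: "\<zeta> = expected_density S Q"
    and prob: "0 < p" "p \<le> 1"
    and inputs: "vr_marina_inputs M S n m b p c I \<xi> pick"
    and X: "X = (\<lambda>k w. fst (vr_marina n m b f Q \<gamma> x0
                   (\<lambda>k. c k w) (\<lambda>i k. I i k w) (\<lambda>i k. \<xi> i k w) k))"
    and xhat: "xhat = (\<lambda>K w. X (pick K w) w)"
    and D: "D = (\<lambda>i k w. grad (local_loss m f i) (X (Suc k) w) - grad (local_loss m f i) (X k w))"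
    and Dt: "Dt = (\<lambda>i k w. batch_diff b f i (I i k w) (X k w) (X (Suc k) w))"
    and avg_smooth: "average_smoothness M n b \<L> X D Dt"
    and Lbar: "Lbar = rms n L" and \<L>bar: "\<L>bar = rms n \<L>"
    and A: "A = Lbar + sqrt ((1 - p) / (p * real n)
                   * (\<omega> * Lbar\<^sup>2 + (1 + \<omega>) * \<L>bar\<^sup>2 / real b))"
    and stepsize: "0 < \<gamma>" "A \<noteq> 0 \<Longrightarrow> \<gamma> \<le> 1 / A"
    and \<Delta>0: "\<Delta>0 = global_loss n m f x0 - fstar"
    and calls: "calls = (\<lambda>i K w. real (oracle_calls m (\<lambda>k. c k w) (\<lambda>i k. I i k w) i K))"
    and msg: "msg = (\<lambda>i t w. message_of m b f Q (\<lambda>k. X k w)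
                   (\<lambda>k. c k w) (\<lambda>i k. I i k w) (\<lambda>i k. \<xi> i k w) i t)"
  shows "(\<forall>K\<ge>1. integrable M (\<lambda>w. (norm (grad (global_loss n m f) (xhat K w)))\<^sup>2) \<and>
            (\<integral>w. (norm (grad (global_loss n m f) (xhat K w)))\<^sup>2 \<partial>M) \<le> 2 * \<Delta>0 / (\<gamma> * real K))
    \<and> (\<forall>K. \<forall>i<n.
          (\<integral>w. calls i K w \<partial>M) = real m + real K * (p * real m + 2 * (1 - p) * real b))
    \<and> (\<forall>K. \<forall>i<n.
          (\<integral>w. (\<Sum>t\<le>K. charge \<zeta> (msg i t w)) \<partial>M)
             = real CARD('d) + real K * (p * real CARD('d) + (1 - p) * \<zeta>) \<and>
          integrable M (\<lambda>w. \<Sum>t\<le>K. nonzeros (msg i t w)) \<and>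
          (\<integral>w. (\<Sum>t\<le>K. nonzeros (msg i t w)) \<partial>M)
             \<le> real CARD('d) + real K * (p * real CARD('d) + (1 - p) * \<zeta>))
    \<and> ((A = 0 \<or> \<gamma> = 1 / A) \<longrightarrow>
        (\<forall>\<epsilon>>0. \<exists>K\<ge>1.
           real K \<le> 2 * (\<Delta>0 / \<epsilon>\<^sup>2 * A) + 1 \<and>
           (\<integral>w. (norm (grad (global_loss n m f) (xhat K w)))\<^sup>2 \<partial>M) \<le> \<epsilon>\<^sup>2 \<and>
           (\<forall>i<n. (\<integral>w. calls i K w \<partial>M)
              \<le> 4 * (real m + \<Delta>0 / \<epsilon>\<^sup>2 * A * (p * real m + (1 - p) * real b))) \<and>
           (\<forall>i<n. (\<integral>w. (\<Sum>t\<le>K. charge \<zeta> (msg i t w)) \<partial>M)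
              \<le> 2 * (real CARD('d) + \<Delta>0 / \<epsilon>\<^sup>2 * A * (p * real CARD('d) + (1 - p) * \<zeta>)))))"
proof -
  interpret V: vr_marina_run f n m b M S Q c I \<xi> pick x0 \<gamma> p \<omega> fstar L \<L> X D Dt
    by unfold_locales (fact assms)+
  have A_noise: "A = rms n L + sqrt ((1 - p) / p * V.noise)"
    unfolding A Lbar \<L>bar V.noise_def by (simp add: field_simps)
  have A_nonneg: "0 \<le> A" "Lbar \<le> A"
    using rms_sq(2)[of n L] V.noise_nonneg prob unfolding A_noise Lbar by auto
  \<comment> \<open>For \<open>A = 0\<close> there is no upper bound on \<gamma>, but the product is
    0.\<close>
  have "\<gamma> * A \<le> 1"
    using stepsize A_nonneg by (cases "A = 0") (auto simp: field_simps)
  then have sum_le: "(\<Sum>k<K. \<integral>w. (norm (grad (global_loss n m f) (X k w)))\<^sup>2 \<partial>M) \<le> 2 * \<Delta>0 / \<gamma>" for K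
    unfolding A_noise \<Delta>0 by (rule V.sum_integral_grad_le)
  have \<Delta>0_nonneg: "0 \<le> \<Delta>0" using lower_bound by (simp add: \<Delta>0)
  have \<zeta>: "0 \<le> \<zeta>" "\<zeta> \<le> real CARD('d)"
    using V.density_bounds by (auto simp: density)
  have grad_bound: "integrable M (\<lambda>w. (norm (grad (global_loss n m f) (xhat K w)))\<^sup>2)"
      "(\<integral>w. (norm (grad (global_loss n m f) (xhat K w)))\<^sup>2 \<partial>M) \<le> 2 * \<Delta>0 / (\<gamma> * real K)"
    if K: "1 \<le> K" for K
  proof -
    show "integrable M (\<lambda>w. (norm (grad (global_loss n m f) (xhat K w)))\<^sup>2)"
      unfolding xhat by (rule V.returned_point(1)[OF K])
    have "(\<integral>w. (norm (grad (global_loss n m f) (xhat K w)))\<^sup>2 \<partial>M) \<le> (2 * \<Delta>0 / \<gamma>) / real K"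
      unfolding xhat V.returned_point(2)[OF K] using sum_le K by (intro divide_right_mono) auto
    then show "(\<integral>w. (norm (grad (global_loss n m f) (xhat K w)))\<^sup>2 \<partial>M) \<le> 2 * \<Delta>0 / (\<gamma> * real K)"
      by simp
  qed
  have calls_eq: "(\<integral>w. calls i K w \<partial>M) = real m + real K * (p * real m + 2 * (1 - p) * real b)"
    if "i < n" for i K
    unfolding calls by (rule V.expected_calls[OF that])
  have charge_eq: "(\<integral>w. (\<Sum>t\<le>K. charge \<zeta> (msg i t w)) \<partial>M)
      = real CARD('d) + real K * (p * real CARD('d) + (1 - p) * \<zeta>)" for i K
    unfolding msg by (rule V.expected_charge)
  have complexity: "\<exists>K\<ge>1.
           real K \<le> 2 * (\<Delta>0 / \<epsilon>\<^sup>2 * A) + 1 \<and>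
           (\<integral>w. (norm (grad (global_loss n m f) (xhat K w)))\<^sup>2 \<partial>M) \<le> \<epsilon>\<^sup>2 \<and>
           (\<forall>i<n. (\<integral>w. calls i K w \<partial>M)
              \<le> 4 * (real m + \<Delta>0 / \<epsilon>\<^sup>2 * A * (p * real m + (1 - p) * real b))) \<and>
           (\<forall>i<n. (\<integral>w. (\<Sum>t\<le>K. charge \<zeta> (msg i t w)) \<partial>M)
              \<le> 2 * (real CARD('d) + \<Delta>0 / \<epsilon>\<^sup>2 * A * (p * real CARD('d) + (1 - p) * \<zeta>)))"
    if \<gamma>: "A = 0 \<or> \<gamma> = 1 / A" and \<epsilon>: "0 < \<epsilon>" for \<epsilon>
  proof -
    \<comment> \<open>With \<gamma> = 1 / A the gradient bound reads
      \<open>\<epsilon>\<^sup>2 * (2 * T) / real K\<close>, so any K \<ge> 2 T is enough; rounding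
      up costs at most one further iteration.\<close>
    define T where "T = \<Delta>0 / \<epsilon>\<^sup>2 * A"
    have T: "0 \<le> T" using \<Delta>0_nonneg A_nonneg by (simp add: T_def)
    obtain K :: nat where K: "1 \<le> K" "real K \<le> 2 * T + 1" "2 * T \<le> real K"
      using ceiling_at_least_one[of "2 * T"] T by auto
    have accuracy: "(\<integral>w. (norm (grad (global_loss n m f) (xhat K w)))\<^sup>2 \<partial>M) \<le> \<epsilon>\<^sup>2"
    \<comment> \<open>If \<open>A = 0\<close>, the bound
      \<open>2 * \<Delta>0 / (\<gamma> * real K)\<close> cannot be expressed through
      \<open>A\<close>. But then \<open>Lbar\<close> is 0 as well, and a flat function bounded below
      has gradient 0 everywhere.\<close>
    proof (cases "A = 0")
      case True
      then have "Lbar = 0" using A_nonneg rms_sq(2)[of n L] by (simp add: Lbar)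
      then have "smooth_with 0 (global_loss n m f)"
        using V.smooth_global_loss by (simp add: Lbar)
      then have "grad (global_loss n m f) x = 0" for x
        by (rule grad_eq_0_if_flat_bounded_below[OF V.global_loss_differentiable _ lower_bound])
      then show ?thesis by simp
    next
      case False
      then have "2 * \<Delta>0 / (\<gamma> * real K) = 2 * \<Delta>0 * A / real K" using \<gamma> by simp
      also have "\<dots> = \<epsilon>\<^sup>2 * (2 * T) / real K" using \<epsilon> by (simp add: T_def)
      also have "\<dots> \<le> \<epsilon>\<^sup>2"
        using mult_left_mono[OF K(3), of "\<epsilon>\<^sup>2"] K(1) by (simp add: divide_le_eq)
      finally show ?thesis using grad_bound(2)[OF K(1)] by linarith
    qed
    \<comment> \<open>Origin of the constant 4: 2 T iterations with two calls per minibatch element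
      give the factor 4 T, and the surplus iteration costs p m + 2 (1 - p) b \<le> 2 m, which with
      the initial m stays below 4 m.\<close>
    have pm: "0 \<le> p * real m" "0 \<le> (1 - p) * real b" "(1 - p) * real b \<le> (1 - p) * real m"
      using prob V.batch_size_le by (auto intro: mult_left_mono)
    have "real K * (p * real m + 2 * (1 - p) * real b) \<le> (2 * T + 1) * (p * real m + 2 * (1 - p) * real b)"
      by (intro mult_right_mono[OF K(2)] add_nonneg_nonneg mult_nonneg_nonneg) (use prob in auto)
    also have "\<dots> = 2 * T * (p * real m) + 4 * T * ((1 - p) * real b) + p * real m + 2 * ((1 - p) * real b)"
      by (simp add: algebra_simps)
    also have "\<dots> \<le> 4 * T * (p * real m) + 4 * T * ((1 - p) * real b) + p * real m + 2 * ((1 - p) * real m)"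
      using pm T mult_nonneg_nonneg[OF T pm(1)] by (intro add_mono) auto
    finally have "real K * (p * real m + 2 * (1 - p) * real b)
        \<le> 4 * T * (p * real m) + 4 * T * ((1 - p) * real b) + p * real m + 2 * ((1 - p) * real m)" .
    moreover have "2 * ((1 - p) * real m) = 2 * real m - 2 * (p * real m)"
      and "4 * (real m + T * (p * real m + (1 - p) * real b))
        = 4 * real m + 4 * T * (p * real m) + 4 * T * ((1 - p) * real b)"
      by (simp_all add: algebra_simps)
    ultimately have calls_le: "real m + real K * (p * real m + 2 * (1 - p) * real b)
        \<le> 4 * (real m + T * (p * real m + (1 - p) * real b))"
      using pm(1) of_nat_0_le_iff[of m, where 'a = real] by linarith
    define B where "B = p * real CARD('d) + (1 - p) * \<zeta>"
    have "B \<le> p * real CARD('d) + (1 - p) * real CARD('d)"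
      unfolding B_def using prob \<zeta> by (intro add_mono mult_left_mono) auto
    then have B: "0 \<le> B" "B \<le> real CARD('d)"
      unfolding B_def using prob \<zeta>
      by (intro add_nonneg_nonneg mult_nonneg_nonneg, auto simp: algebra_simps)
    \<comment> \<open>The surplus iteration costs at most d, like the initial message, hence the
      constant 2.\<close>
    have "real K * B \<le> (2 * T + 1) * B"
      using K(2) B by (intro mult_right_mono) auto
    also have "\<dots> \<le> 2 * (T * B) + real CARD('d)" using B by (simp add: algebra_simps)
    finally have charge_le: "real CARD('d) + real K * B \<le> 2 * (real CARD('d) + T * B)" by simp
    show ?thesis
      unfolding T_def[symmetric] using K accuracy calls_le charge_le
      by (intro exI[of _ K]) (simp add: calls_eq charge_eq B_def)
  qed
  show ?thesis
    using grad_bound calls_eq charge_eq complexity V.expected_nonzeros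
    unfolding msg density by blast
qed

end
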